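(* Let $\delta>0$ and let $(T_N)_{N\in\mathbb{N}}$ be a sequence with $T_N\in2\mathbb{N}$, $T_N\le N$, $T_N\to\infty$. Suppose there are $\zeta\in\mathbb{R}$ and a subsequence $(N')$ with $T_{N'}-\frac{\log N'}{c_\delta}\to\zeta$. Then, under $\mathbf P^{T_{N'}}_{N',\delta}$, as $N'\to\infty$, $$\frac{S_{N'}}{T_{N'}}\Longrightarrow \widetilde S_\Gamma,$$ where $(\widetilde S_n)_{n\ge0}$ is a simple symmetric random walk on $\mathbb Z$ started at $0$ and $\Gamma$ is independent of $(\widetilde S_n)$ with Poisson law of parameter $t_{\delta,\zeta}:=2e^\delta\frac{(1-e^{-\delta})^2}{2-e^{-\delta}}\,e^{-c_\delta\zeta}$.
   Context: $(S_n)_{n\ge0}$ is the simple symmetric random walk on $\mathbb{Z}$ started at $0$, with law $\mathbf P$. For $T\in2\mathbb{N}$, $N\in\mathbb{N}$, $\delta\in\mathbb{R}$, the polymer measure $\mathbf P^T_{N,\delta}$ is defined by $\frac{d\mathbf P^T_{N,\delta}}{d\mathbf P}(S)=\frac{\exp(\delta\sum_{i=1}^N\mathbf 1_{\{S_i\in T\mathbb Z\}})}{Z^T_{N,\delta}}$, with $Z^T_{N,\delta}$ the normalizing constant. The constant $c_\delta:=\frac{\delta}{2}+\log\sqrt{2-e^{-\delta}}$. $\Longrightarrow$ denotes convergence in law. *)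

theory Defs
  imports "HOL-Probability.Probability"
begin

text \<open>A path of the walk up to time N is encoded by its list of increments
  (each in {-1,1}); the walk position at time i is the sum of the first i increments.
  The law of the simple symmetric random walk up to time N is the uniform law on such lists.\<close>

definition srw_steps :: "nat \<Rightarrow> int list pmf" where
  "srw_steps N = pmf_of_set {xs. length xs = N \<and> set xs \<subseteq> {-1, 1}}"

definition walk_pos :: "int list \<Rightarrow> nat \<Rightarrow> int" where
  "walk_pos xs i = sum_list (take i xs)"

definition c_delta :: "real \<Rightarrow> real" where
  "c_delta \<delta> = \<delta> / 2 + ln (sqrt (2 - exp (- \<delta>)))"

definition visits :: "nat \<Rightarrow> nat \<Rightarrow> int list \<Rightarrow> nat" where
  "visits T N xs = card {i \<in> {1..N}. int T dvd walk_pos xs i}"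

definition partition_fn :: "nat \<Rightarrow> nat \<Rightarrow> real \<Rightarrow> real" where
  "partition_fn T N \<delta> = measure_pmf.expectation (srw_steps N) (\<lambda>xs. exp (\<delta> * real (visits T N xs)))"

definition polymer :: "nat \<Rightarrow> nat \<Rightarrow> real \<Rightarrow> int list measure" where
  "polymer T N \<delta> = density (measure_pmf (srw_steps N))
     (\<lambda>xs. ennreal (exp (\<delta> * real (visits T N xs)) / partition_fn T N \<delta>))"

definition polymer_rescaled_endpoint :: "nat \<Rightarrow> nat \<Rightarrow> real \<Rightarrow> real measure" where
  "polymer_rescaled_endpoint T N \<delta> =
     distr (polymer T N \<delta>) borel (\<lambda>xs. real_of_int (walk_pos xs N) / real T)"

definition t_param :: "real \<Rightarrow> real \<Rightarrow> real" where
  "t_param \<delta> \<zeta> = 2 * exp \<delta> * (1 - exp (- \<delta>))\<^sup>2 / (2 - exp (- \<delta>)) * exp (- c_delta \<delta> * \<zeta>)"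

definition srw_at_poisson :: "real \<Rightarrow> int pmf" where
  "srw_at_poisson t = bind_pmf (poisson_pmf t) (\<lambda>n. map_pmf (\<lambda>xs. walk_pos xs n) (srw_steps n))"

end

theory Submission
  imports Defs
begin

text \<open>
  By Levy's continuity theorem it suffices to follow the characteristic function, a ratio of two tilted
  partition functions. Watched at even times, such a function is a power of a self-adjoint operator:
  a lazy walk with period \<^term>\<open>m = T div 2\<close>, twisted by the phase \<^term>\<open>cis u\<close> per period and
  reweighted at one site. It has exactly one eigenvalue above 1, with an explicit eigenvector built from
  \<^term>\<open>r ^ y\<close> and \<^term>\<open>r ^ (m - y)\<close>; on the orthogonal complement it is a contraction. The eigenvalue
  equation for \<^term>\<open>r\<close> gives \<^term>\<open>r = b - (1 - b\<^sup>2) * cos u * b ^ m\<close> to first order, where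
  \<^term>\<open>b = exp (- 2 * c_delta \<delta>)\<close>. Since \<^term>\<open>N * b ^ m\<close> converges, the ratio of the powers
  tends to \<^term>\<open>exp (t * (cos u - 1))\<close>, the characteristic function of the walk at a Poisson time.
\<close>

subsection \<open>Tilted path averages and characteristic functions\<close>

definition step_lists :: "nat \<Rightarrow> int list set" where
  "step_lists N = {xs. length xs = N \<and> set xs \<subseteq> {-1, 1}}"

lemma step_lists_0: "step_lists 0 = {[]}"
  by (auto simp: step_lists_def)

lemma step_lists_Suc: "step_lists (Suc N) = (#) 1 ` step_lists N \<union> (#) (-1) ` step_lists N"
  by (auto simp: step_lists_def length_Suc_conv image_iff)

lemma finite_step_lists: "finite (step_lists N)"
  by (induction N) (auto simp: step_lists_0 step_lists_Suc)

lemma sum_step_lists_Suc: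
  fixes f :: "int list \<Rightarrow> 'a::comm_monoid_add"
  shows "sum f (step_lists (Suc N)) = (\<Sum>xs\<in>step_lists N. f (1 # xs)) + (\<Sum>xs\<in>step_lists N. f (-1 # xs))"
  unfolding step_lists_Suc
  by (subst sum.union_disjoint) (auto simp: finite_step_lists sum.reindex)

lemma card_step_lists: "card (step_lists N) = 2 ^ N"
proof (induction N)
  case (Suc N)
  have "card (step_lists (Suc N)) = (\<Sum>xs\<in>step_lists (Suc N). 1)" by simp
  also have "\<dots> = 2 ^ Suc N" unfolding sum_step_lists_Suc using Suc by simp
  finally show ?case .
qed (simp add: step_lists_0)

lemma step_lists_nonempty: "step_lists N \<noteq> {}"
  by (induction N) (auto simp: step_lists_0 step_lists_Suc)

lemma expectation_srw_steps:
  fixes f :: "int list \<Rightarrow> 'a::{banach, second_countable_topology}"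
  shows "measure_pmf.expectation (srw_steps N) f = (\<Sum>xs\<in>step_lists N. f xs) /\<^sub>R 2 ^ N"
proof -
  note ne = step_lists_nonempty[of N]
  have "measure_pmf.expectation (srw_steps N) f = (\<Sum>xs\<in>step_lists N. pmf (pmf_of_set (step_lists N)) xs *\<^sub>R f xs)"
    unfolding srw_steps_def step_lists_def[symmetric]
    by (rule integral_measure_pmf) (use finite_step_lists ne in auto)
  also have "\<dots> = (\<Sum>xs\<in>step_lists N. f xs /\<^sub>R 2 ^ N)"
    by (intro sum.cong refl) (use finite_step_lists ne in \<open>simp add: card_step_lists inverse_eq_divide\<close>)
  finally show ?thesis by (simp add: scaleR_sum_right)
qed

definition site_weight :: "nat \<Rightarrow> real \<Rightarrow> int \<Rightarrow> real" where
  "site_weight T \<delta> x = (if int T dvd x then exp \<delta> else 1)"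

definition visits_from :: "nat \<Rightarrow> int \<Rightarrow> nat \<Rightarrow> int list \<Rightarrow> nat" where
  "visits_from T x N xs = card {i \<in> {1..N}. int T dvd x + walk_pos xs i}"

lemma visits_from_Cons:
  "visits_from T x (Suc N) (s # xs) = of_bool (int T dvd x + s) + visits_from T (x + s) N xs"
proof -
  have card_eq: "card {i \<in> {1..n}. P i} = (\<Sum>i=1..n. of_bool (P i))" for n and P :: "nat \<Rightarrow> bool"
    by (simp add: of_bool_def sum.inter_filter[symmetric])
  show ?thesis
    unfolding visits_from_def card_eq
    by (subst sum.atLeast_Suc_atMost) (simp_all add: sum.shift_bounds_cl_Suc_ivl walk_pos_def add.assoc
      del: sum.cl_ivl_Suc)
qed

lemma exp_visits_from_Cons:
  "exp (\<delta> * real (visits_from T x (Suc N) (s # xs)))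
     = site_weight T \<delta> (x + s) * exp (\<delta> * real (visits_from T (x + s) N xs))"
  by (simp add: visits_from_Cons site_weight_def exp_add ring_distribs)

definition tilted_avg :: "nat \<Rightarrow> real \<Rightarrow> real \<Rightarrow> nat \<Rightarrow> int \<Rightarrow> complex" where
  "tilted_avg T \<delta> \<theta> N x = (\<Sum>xs\<in>step_lists N.
     cis (\<theta> * real_of_int (x + sum_list xs)) * of_real (exp (\<delta> * real (visits_from T x N xs)))) / 2 ^ N"

lemma tilted_avg_0: "tilted_avg T \<delta> \<theta> 0 x = cis (\<theta> * real_of_int x)"
  by (simp add: tilted_avg_def step_lists_0 visits_from_def)

lemma tilted_avg_Suc:
  "tilted_avg T \<delta> \<theta> (Suc N) x =
     (site_weight T \<delta> (x + 1) * tilted_avg T \<delta> \<theta> N (x + 1)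
      + site_weight T \<delta> (x - 1) * tilted_avg T \<delta> \<theta> N (x - 1)) / 2"
  unfolding tilted_avg_def sum_step_lists_Suc exp_visits_from_Cons
  by (simp add: sum_distrib_left field_simps sum_divide_distrib)

lemma partition_fn_eq: "of_real (partition_fn T N \<delta>) = tilted_avg T \<delta> 0 N 0"
  unfolding partition_fn_def expectation_srw_steps tilted_avg_def
  by (simp add: visits_def visits_from_def divide_inverse scaleR_conv_of_real mult.commute)

lemma partition_fn_pos: "partition_fn T N \<delta> > 0"
  unfolding partition_fn_def expectation_srw_steps
  by (auto intro!: mult_pos_pos sum_pos simp: finite_step_lists step_lists_nonempty)

lemma prob_space_polymer: "prob_space (polymer T N \<delta>)"
proof
  let ?f = "\<lambda>xs. exp (\<delta> * real (visits T N xs)) / partition_fn T N \<delta>"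
  have Z: "partition_fn T N \<delta> > 0" by (rule partition_fn_pos)
  have fin: "finite (set_pmf (srw_steps N))"
    unfolding srw_steps_def step_lists_def[symmetric] by (simp add: finite_step_lists step_lists_nonempty)
  have "emeasure (polymer T N \<delta>) (space (polymer T N \<delta>)) = (\<integral>\<^sup>+xs. ennreal (?f xs) \<partial>measure_pmf (srw_steps N))"
    unfolding polymer_def by (subst emeasure_density) auto
  also have "\<dots> = ennreal (\<integral>xs. ?f xs \<partial>measure_pmf (srw_steps N))"
    using Z by (intro nn_integral_eq_integral integrable_measure_pmf_finite fin) auto
  also have "(\<integral>xs. ?f xs \<partial>measure_pmf (srw_steps N)) = 1"
    using Z by (simp add: partition_fn_def)
  finally show "emeasure (polymer T N \<delta>) (space (polymer T N \<delta>)) = 1" by simp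
qed

lemma real_distribution_polymer_rescaled_endpoint:
  "real_distribution (polymer_rescaled_endpoint T N \<delta>)"
proof -
  interpret prob_space "polymer T N \<delta>" by (rule prob_space_polymer)
  show ?thesis
    unfolding polymer_rescaled_endpoint_def
    by (rule real_distribution_distr) (simp add: polymer_def)
qed

lemma char_polymer_rescaled_endpoint:
  "char (polymer_rescaled_endpoint T N \<delta>) u = tilted_avg T \<delta> (u / real T) N 0 / tilted_avg T \<delta> 0 N 0"
proof -
  let ?Z = "partition_fn T N \<delta>"
  have Z: "?Z > 0" by (rule partition_fn_pos)
  have pos: "walk_pos xs N = sum_list xs" if "xs \<in> step_lists N" for xs
    using that by (simp add: walk_pos_def step_lists_def)
  have "char (polymer_rescaled_endpoint T N \<delta>) u
      = (CLINT xs|polymer T N \<delta>. iexp (u * (real_of_int (walk_pos xs N) / real T)))"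
    unfolding char_def polymer_rescaled_endpoint_def
    by (subst integral_distr) (simp_all add: polymer_def)
  also have "\<dots> = (CLINT xs|measure_pmf (srw_steps N). (exp (\<delta> * real (visits T N xs)) / ?Z) *\<^sub>R
                    iexp (u * (real_of_int (walk_pos xs N) / real T)))"
    unfolding polymer_def by (subst integral_density) (use Z in auto)
  also have "\<dots> = (\<Sum>xs\<in>step_lists N. (exp (\<delta> * real (visits T N xs)) / ?Z) *\<^sub>R
                    iexp (u * (real_of_int (walk_pos xs N) / real T))) /\<^sub>R 2 ^ N"
    by (rule expectation_srw_steps)
  also have "\<dots> = (\<Sum>xs\<in>step_lists N. cis (u / real T * real_of_int (0 + sum_list xs))
                     * of_real (exp (\<delta> * real (visits_from T 0 N xs))) / of_real ?Z) /\<^sub>R 2 ^ N"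
    by (intro arg_cong2[where f = scaleR] sum.cong refl)
       (simp add: pos cis_conv_exp visits_def visits_from_def scaleR_conv_of_real field_simps)
  also have "\<dots> = tilted_avg T \<delta> (u / real T) N 0 / of_real ?Z"
    unfolding tilted_avg_def by (simp add: sum_divide_distrib scaleR_conv_of_real field_simps)
  finally show ?thesis by (simp add: partition_fn_eq)
qed

lemma sum_cis_step_lists: "(\<Sum>xs\<in>step_lists n. cis (u * real_of_int (sum_list xs))) = of_real ((2 * cos u) ^ n)"
proof (induction n)
  case (Suc n)
  have "(\<Sum>xs\<in>step_lists (Suc n). cis (u * real_of_int (sum_list xs)))
      = (cis u + cis (-u)) * (\<Sum>xs\<in>step_lists n. cis (u * real_of_int (sum_list xs)))"
    unfolding sum_step_lists_Suc
    by (simp add: sum_distrib_left sum.distrib cis_mult algebra_simps)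
  also have "cis u + cis (-u) = of_real (2 * cos u)"
    by (simp add: complex_eq_iff)
  finally show ?case using Suc by simp
qed (simp add: step_lists_0)

lemma integral_bind_pmf_complex:
  fixes f :: "'b \<Rightarrow> complex"
  assumes "\<And>x. cmod (f x) \<le> B"
  shows "integral\<^sup>L (measure_pmf (bind_pmf p q)) f = (\<integral>x. integral\<^sup>L (measure_pmf (q x)) f \<partial>measure_pmf p)"
proof -
  have real: "integral\<^sup>L (measure_pmf (bind_pmf p q)) g = (\<integral>x. integral\<^sup>L (measure_pmf (q x)) g \<partial>measure_pmf p)"
    if "\<And>x. \<bar>g x\<bar> \<le> B" for g :: "'b \<Rightarrow> real"
    unfolding measure_pmf_bind
    by (rule integral_bind[where K = "count_space UNIV" and B = B and B' = 1])
       (use that measurable_measure_pmf[of q] in \<open>auto simp: measure_pmf.emeasure_space_1 intro: measure_pmf.finite_measure\<close>)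
  have int: "integrable (measure_pmf p') f" for p' :: "'b pmf"
    by (rule measure_pmf.integrable_const_bound[where B = B]) (use assms in auto)
  have bd: "cmod (integral\<^sup>L (measure_pmf (q x)) f) \<le> B" for x
    by (rule order_trans[OF integral_norm_bound])
       (rule measure_pmf.integral_le_const, use assms int in auto)
  have int2: "integrable (measure_pmf p) (\<lambda>x. integral\<^sup>L (measure_pmf (q x)) f)"
    by (rule measure_pmf.integrable_const_bound[where B = B]) (use bd in auto)
  show ?thesis
  proof (rule complex_eqI)
    show "Re (integral\<^sup>L (measure_pmf (bind_pmf p q)) f) = Re (\<integral>x. integral\<^sup>L (measure_pmf (q x)) f \<partial>measure_pmf p)"
      using real[of "\<lambda>x. Re (f x)"] int int2 abs_Re_le_cmod assms
      by (simp flip: integral_Re) (meson order_trans)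
    show "Im (integral\<^sup>L (measure_pmf (bind_pmf p q)) f) = Im (\<integral>x. integral\<^sup>L (measure_pmf (q x)) f \<partial>measure_pmf p)"
      using real[of "\<lambda>x. Im (f x)"] int int2 abs_Im_le_cmod assms
      by (simp flip: integral_Im) (meson order_trans)
  qed
qed

lemma char_srw_at_poisson:
  assumes "t > 0"
  shows "char (distr (measure_pmf (srw_at_poisson t)) borel real_of_int) u = of_real (exp (t * (cos u - 1)))"
proof -
  have "char (distr (measure_pmf (srw_at_poisson t)) borel real_of_int) u
      = (CLINT x|measure_pmf (srw_at_poisson t). cis (u * real_of_int x))"
    unfolding char_def by (subst integral_distr) (simp_all add: cis_conv_exp)
  also have "\<dots> = (CLINT n|measure_pmf (poisson_pmf t). CLINT xs|measure_pmf (srw_steps n). cis (u * real_of_int (walk_pos xs n)))"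
    unfolding srw_at_poisson_def by (subst integral_bind_pmf_complex[where B = 1]) simp_all
  also have "\<dots> = (CLINT n|measure_pmf (poisson_pmf t). of_real (cos u ^ n))"
  proof (intro Bochner_Integration.integral_cong refl)
    fix n
    have "(CLINT xs|measure_pmf (srw_steps n). cis (u * real_of_int (walk_pos xs n)))
        = (\<Sum>xs\<in>step_lists n. cis (u * real_of_int (sum_list xs))) /\<^sub>R 2 ^ n"
      unfolding expectation_srw_steps
      by (intro arg_cong2[where f = scaleR] sum.cong refl) (simp add: walk_pos_def step_lists_def)
    then show "(CLINT xs|measure_pmf (srw_steps n). cis (u * real_of_int (walk_pos xs n))) = of_real (cos u ^ n)"
      by (simp add: sum_cis_step_lists power_mult_distrib scaleR_conv_of_real)
  qed
  also have "\<dots> = of_real (\<integral>n. cos u ^ n \<partial>measure_pmf (poisson_pmf t))"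
    by (rule integral_complex_of_real)
  also have "(\<integral>n. cos u ^ n \<partial>measure_pmf (poisson_pmf t)) = (\<integral>n. pmf (poisson_pmf t) n * cos u ^ n \<partial>count_space UNIV)"
    unfolding measure_pmf_eq_density by (subst integral_density) simp_all
  also have "\<dots> = (\<Sum>n. pmf (poisson_pmf t) n * cos u ^ n)"
  proof (rule integral_count_space_nat)
    have "integrable (measure_pmf (poisson_pmf t)) (\<lambda>n. cos u ^ n)"
      by (rule measure_pmf.integrable_const_bound[where B = 1]) (auto simp: power_abs power_le_one)
    then show "integrable (count_space UNIV) (\<lambda>n. pmf (poisson_pmf t) n * cos u ^ n)"
      unfolding measure_pmf_eq_density by (subst (asm) integrable_density) simp_all
  qed
  also have "\<dots> = (\<Sum>n. exp (-t) * ((t * cos u) ^ n /\<^sub>R fact n))"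
    using assms by (simp add: power_mult_distrib field_simps)
  also have "\<dots> = exp (-t) * exp (t * cos u)"
    by (subst suminf_mult[OF summable_exp_generic]) (simp add: exp_def)
  also have "\<dots> = exp (t * (cos u - 1))"
    by (simp add: exp_add[symmetric] algebra_simps)
  finally show ?thesis .
qed

subsection \<open>The two-step operator\<close>

text \<open>Two steps of the walk between even sites (the site \<^term>\<open>2 * y\<close> is written \<^term>\<open>y\<close>),
  when the spacing of the pinning sites is twice \<^term>\<open>m\<close>.\<close>
definition pinned_lazy_step :: "nat \<Rightarrow> real \<Rightarrow> (int \<Rightarrow> complex) \<Rightarrow> int \<Rightarrow> complex" where
  "pinned_lazy_step m \<delta> f y = (of_real (site_weight m \<delta> (y + 1)) * f (y + 1) + 2 * of_real (site_weight m \<delta> y) * f y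
     + of_real (site_weight m \<delta> (y - 1)) * f (y - 1)) / 4"

definition plane_wave :: "nat \<Rightarrow> real \<Rightarrow> int \<Rightarrow> complex" where
  "plane_wave m u y = cis (u * real_of_int y / real m)"

lemma pinned_lazy_step_lin:
  "pinned_lazy_step m \<delta> (\<lambda>y. a * f y - b * g y) = (\<lambda>y. a * pinned_lazy_step m \<delta> f y - b * pinned_lazy_step m \<delta> g y)"
  by (rule ext) (simp add: pinned_lazy_step_def field_simps)

lemma funpow_pinned_lazy_step_lin:
  "(pinned_lazy_step m \<delta> ^^ n) (\<lambda>y. a * f y - b * g y)
     = (\<lambda>y. a * (pinned_lazy_step m \<delta> ^^ n) f y - b * (pinned_lazy_step m \<delta> ^^ n) g y)"
  by (induction n) (simp_all add: pinned_lazy_step_lin)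

lemma site_weight_odd: "site_weight (2 * m) \<delta> (2 * z + 1) = 1"
  unfolding site_weight_def by (metis dvd_mult_left even_plus_one_iff even_mult_iff even_numeral of_nat_mult of_nat_numeral)

lemma tilted_avg_two_steps:
  "tilted_avg (2 * m) \<delta> \<theta> (Suc (Suc N)) (2 * y) = pinned_lazy_step m \<delta> (\<lambda>y. tilted_avg (2 * m) \<delta> \<theta> N (2 * y)) y"
proof -
  note odd = site_weight_odd[of m \<delta>]
  have even: "site_weight (2 * m) \<delta> (2 * z) = site_weight m \<delta> z" for z
    by (simp add: site_weight_def)
  have "2 * y - 1 = 2 * (y - 1) + 1" "2 * y + 1 + 1 = 2 * (y + 1)" "2 * y - 1 - 1 = 2 * (y - 1)" by simp_all
  then show ?thesis
    unfolding pinned_lazy_step_def tilted_avg_Suc using odd[of y] odd[of "y - 1"] even[of y] even[of "y + 1"] even[of "y - 1"]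
    by (simp add: add_divide_distrib algebra_simps)
qed

lemma tilted_avg_even_steps:
  "tilted_avg (2 * m) \<delta> \<theta> (j + 2 * n) (2 * y) = (pinned_lazy_step m \<delta> ^^ n) (\<lambda>y. tilted_avg (2 * m) \<delta> \<theta> j (2 * y)) y"
  by (induction n arbitrary: y) (simp_all add: tilted_avg_two_steps)

lemma tilted_avg_1: "tilted_avg (2 * m) \<delta> \<theta> 1 (2 * y) = of_real (cos \<theta>) * tilted_avg (2 * m) \<delta> \<theta> 0 (2 * y)"
proof -
  note odd = site_weight_odd[of m \<delta>]
  have "site_weight (2 * m) \<delta> (2 * y - 1) = 1" using odd[of "y - 1"] by simp
  moreover have "cis (\<theta> * (x + 1)) + cis (\<theta> * (x - 1)) = 2 * of_real (cos \<theta>) * cis (\<theta> * x)" for x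
    by (simp add: complex_eq_iff cos_add cos_diff sin_add sin_diff algebra_simps)
  from this[of "2 * real_of_int y"] have "cis (\<theta> * (2 * real_of_int y + 1)) + cis (\<theta> * (2 * real_of_int y - 1))
      = 2 * of_real (cos \<theta>) * cis (\<theta> * (2 * real_of_int y))" .
  ultimately show ?thesis
    by (simp add: tilted_avg_Suc tilted_avg_0 odd)
qed

lemma tilted_avg_eq_funpow:
  assumes "m > 0"
  shows "tilted_avg (2 * m) \<delta> (u / real (2 * m)) N 0
     = of_real (if even N then 1 else cos (u / real (2 * m))) * (pinned_lazy_step m \<delta> ^^ (N div 2)) (plane_wave m u) 0"
proof -
  have wave: "(\<lambda>y. tilted_avg (2 * m) \<delta> (u / real (2 * m)) 0 (2 * y)) = plane_wave m u"
    by (rule ext) (simp add: tilted_avg_0 plane_wave_def)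
  show ?thesis
  proof (cases "even N")
    case True
    then have "N = 0 + 2 * (N div 2)" by simp
    then show ?thesis using tilted_avg_even_steps[of m \<delta> "u / real (2 * m)" 0 "N div 2" 0] wave True by simp
  next
    case False
    define c where "c = complex_of_real (cos (u / real (2 * m)))"
    have N: "1 + 2 * (N div 2) = N" using False by presburger
    have "tilted_avg (2 * m) \<delta> (u / real (2 * m)) N 0
        = (pinned_lazy_step m \<delta> ^^ (N div 2)) (\<lambda>y. tilted_avg (2 * m) \<delta> (u / real (2 * m)) 1 (2 * y)) 0"
      using tilted_avg_even_steps[of m \<delta> "u / real (2 * m)" 1 "N div 2" 0] unfolding N by simp
    also have "(\<lambda>y. tilted_avg (2 * m) \<delta> (u / real (2 * m)) 1 (2 * y)) = (\<lambda>y. c * plane_wave m u y - 0 * plane_wave m u y)"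
      unfolding tilted_avg_1 wave[symmetric] c_def by simp
    finally show ?thesis using False unfolding funpow_pinned_lazy_step_lin by (simp add: c_def)
  qed
qed

locale pinned_period =
  fixes m :: nat and \<delta> u :: real
  assumes m_pos: "m > 0" and \<delta>_pos: "\<delta> > 0"
begin

abbreviation w :: "int \<Rightarrow> real" where "w \<equiv> site_weight m \<delta>"

definition quasi :: "(int \<Rightarrow> complex) \<Rightarrow> bool" where
  "quasi f \<longleftrightarrow> (\<forall>y. f (y + int m) = cis u * f y)"

abbreviation A :: "(int \<Rightarrow> complex) \<Rightarrow> int \<Rightarrow> complex" where "A \<equiv> pinned_lazy_step m \<delta>"

definition D :: "(int \<Rightarrow> complex) \<Rightarrow> int \<Rightarrow> complex" where
  "D f y = (of_real (w y) * f y + of_real (w (y + 1)) * f (y + 1)) / 2"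

definition ip :: "(int \<Rightarrow> complex) \<Rightarrow> (int \<Rightarrow> complex) \<Rightarrow> complex" where
  "ip f g = (\<Sum>y\<in>{0..<int m}. of_real (w y) * cnj (f y) * g y)"

definition nrm :: "(int \<Rightarrow> complex) \<Rightarrow> real" where
  "nrm f = (\<Sum>y\<in>{0..<int m}. w y * (cmod (f y))\<^sup>2)"

definition energy :: "(int \<Rightarrow> complex) \<Rightarrow> real" where
  "energy f = (\<Sum>y\<in>{0..<int m}. (cmod (D f y))\<^sup>2)"

lemma w_pos: "w y > 0"
  by (simp add: site_weight_def)

lemma w_period: "w (y + int m) = w y"
  by (simp add: site_weight_def)

lemma w_0: "w 0 = exp \<delta>"
  by (simp add: site_weight_def)

lemma w_1: "0 < y \<Longrightarrow> y < int m \<Longrightarrow> w y = 1"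
  by (auto simp: site_weight_def dest: zdvd_imp_le)

lemma quasiD: "quasi f \<Longrightarrow> f (y + int m) = cis u * f y"
  by (simp add: quasi_def)

lemma quasi_A: "quasi f \<Longrightarrow> quasi (A f)"
proof -
  assume f: "quasi f"
  have "A f (y + int m) = cis u * A f y" for y
    using quasiD[OF f, of y] quasiD[OF f, of "y + 1"] quasiD[OF f, of "y - 1"]
      w_period[of y] w_period[of "y + 1"] w_period[of "y - 1"]
    by (simp add: pinned_lazy_step_def algebra_simps add_divide_distrib)
  then show ?thesis by (simp add: quasi_def)
qed

lemma quasi_lin: "quasi f \<Longrightarrow> quasi g \<Longrightarrow> quasi (\<lambda>y. a * f y - b * g y)"
  by (simp add: quasi_def algebra_simps)

lemma D_lin: "D (\<lambda>y. a * f y - b * g y) y = a * D f y - b * D g y"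
  by (simp add: D_def field_simps)

lemma sum_shift:
  fixes F :: "int \<Rightarrow> 'a::ab_group_add"
  assumes "\<And>y. F (y + int m) = F y"
  shows "(\<Sum>y\<in>{0..<int m}. F (y + 1)) = (\<Sum>y\<in>{0..<int m}. F y)"
proof -
  have "(\<Sum>y\<in>{0..<int m}. F (y + 1)) = (\<Sum>y\<in>{1..<int m + 1}. F y)"
    by (rule sum.reindex_bij_witness[of _ "\<lambda>y. y - 1" "\<lambda>y. y + 1"]) auto
  also have "{1..<int m + 1} = insert (int m) {1..<int m}" using m_pos by auto
  also have "(\<Sum>y\<in>\<dots>. F y) = F 0 + (\<Sum>y\<in>{1..<int m}. F y)" using assms[of 0] by simp
  also have "\<dots> = (\<Sum>y\<in>insert 0 {1..<int m}. F y)" by simp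
  also have "insert 0 {1..<int m} = {0..<int m}" using m_pos by auto
  finally show ?thesis .
qed

lemma quasi_cancel: "quasi f \<Longrightarrow> quasi g \<Longrightarrow> cnj (f (y + int m)) * g (z + int m) = cnj (f y) * g z"
  by (simp add: quasiD cis_cnj cis_mult mult.assoc mult.left_commute[of "cis (-u)"] mult.left_commute[of "cnj (f y)"]
      flip: mult.assoc)

text \<open>Summation by parts: \<^term>\<open>A\<close> is \<^term>\<open>D\<close> followed by its adjoint.\<close>
lemma ip_A:
  assumes f: "quasi f" and g: "quasi g"
  shows "ip f (A g) = (\<Sum>y\<in>{0..<int m}. cnj (D f y) * D g y)"
proof -
  define a where "a y = of_real (w y) * f y" for y
  define b where "b y = of_real (w y) * g y" for y
  have a: "a (y + int m) = cis u * a y" and b: "b (y + int m) = cis u * b y" for y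
    by (simp_all add: a_def b_def quasiD f g w_period)
  have qa: "quasi a" and qb: "quasi b" using a b by (auto simp: quasi_def)
  have s1: "(\<Sum>y\<in>{0..<int m}. cnj (a (y + 1)) * b (y + 1)) = (\<Sum>y\<in>{0..<int m}. cnj (a y) * b y)"
    by (rule sum_shift[where F = "\<lambda>y. cnj (a y) * b y"]) (rule quasi_cancel[OF qa qb])
  have s2: "(\<Sum>y\<in>{0..<int m}. cnj (a (y + 1)) * b y) = (\<Sum>y\<in>{0..<int m}. cnj (a y) * b (y - 1))"
    using sum_shift[where F = "\<lambda>y. cnj (a y) * b (y - 1)"] quasi_cancel[OF qa qb]
    by (simp add: add_diff_eq[symmetric]) (metis (no_types, lifting) add_diff_eq diff_add_eq)
  have "(\<Sum>y\<in>{0..<int m}. cnj (D f y) * D g y)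
     = ((\<Sum>y\<in>{0..<int m}. cnj (a y) * b y) + (\<Sum>y\<in>{0..<int m}. cnj (a y) * b (y + 1))
       + (\<Sum>y\<in>{0..<int m}. cnj (a (y + 1)) * b y) + (\<Sum>y\<in>{0..<int m}. cnj (a (y + 1)) * b (y + 1))) / 4"
    unfolding sum.distrib[symmetric] sum_divide_distrib
    by (intro sum.cong refl) (simp add: D_def a_def b_def field_simps)
  also have "\<dots> = (\<Sum>y\<in>{0..<int m}. cnj (a y) * (b (y + 1) + 2 * b y + b (y - 1)) / 4)"
    unfolding s1 s2 unfolding sum.distrib[symmetric] sum_divide_distrib
    by (intro sum.cong refl) (simp add: field_simps)
  also have "\<dots> = ip f (A g)"
    unfolding ip_def by (intro sum.cong refl) (simp add: pinned_lazy_step_def a_def b_def)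
  finally show ?thesis by simp
qed

lemma cnj_ip: "cnj (ip f g) = ip g f"
  unfolding ip_def by (simp add: mult_ac)

lemma ip_A_sym:
  assumes "quasi f" "quasi g"
  shows "ip (A f) g = ip f (A g)"
proof -
  have "ip (A f) g = cnj (ip g (A f))" by (simp add: cnj_ip)
  then show ?thesis using assms by (simp add: ip_A mult_ac)
qed

lemma ip_self: "ip f f = of_real (nrm f)"
  unfolding ip_def nrm_def
  by (simp add: complex_norm_square mult_ac del: of_real_power)

lemma ip_A_self: "quasi f \<Longrightarrow> ip f (A f) = of_real (energy f)"
  unfolding energy_def by (simp add: ip_A complex_norm_square mult_ac del: of_real_power)

lemma cmod_sq_lin: "(cmod (a * x - b * y))\<^sup>2
   = (cmod a)\<^sup>2 * (cmod x)\<^sup>2 + (cmod b)\<^sup>2 * (cmod y)\<^sup>2 - 2 * Re (cnj a * b * (cnj x * y))"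
  unfolding cmod_power2 by (simp add: power2_eq_square algebra_simps)

lemma nrm_lin: "nrm (\<lambda>y. a * f y - b * g y)
   = (cmod a)\<^sup>2 * nrm f + (cmod b)\<^sup>2 * nrm g - 2 * Re (cnj a * b * ip f g)"
proof -
  have *: "Re (cnj a * b * (of_real r * cnj x * y)) = r * Re (cnj a * b * (cnj x * y))" for r x y
    by (simp add: algebra_simps)
  have "2 * Re (cnj a * b * ip f g) = (\<Sum>y\<in>{0..<int m}. w y * (2 * Re (cnj a * b * (cnj (f y) * g y))))"
    unfolding ip_def sum_distrib_left Re_sum * by (simp only: mult_ac)
  then show ?thesis
    unfolding nrm_def cmod_sq_lin
    by (simp add: sum_distrib_left sum.distrib sum_subtractf algebra_simps del: times_complex.sel)
qed

lemma energy_lin: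
  assumes "quasi f" "quasi g"
  shows "energy (\<lambda>y. a * f y - b * g y)
     = (cmod a)\<^sup>2 * energy f + (cmod b)\<^sup>2 * energy g - 2 * Re (cnj a * b * ip f (A g))"
  unfolding energy_def D_lin cmod_sq_lin ip_A[OF assms]
  by (simp add: sum_distrib_left sum.distrib sum_subtractf del: times_complex.simps)

lemma cmod_avg_sq: "(cmod ((x + y) / 2))\<^sup>2 \<le> ((cmod x)\<^sup>2 + (cmod y)\<^sup>2) / 2"
proof -
  have "(cmod ((x + y) / 2))\<^sup>2 \<le> ((cmod x + cmod y) / 2)\<^sup>2"
    by (intro power_mono) (auto simp: norm_divide norm_triangle_ineq)
  also have "\<dots> \<le> ((cmod x)\<^sup>2 + (cmod y)\<^sup>2) / 2"
    using zero_le_power2[of "cmod x - cmod y"] by (simp add: power2_eq_square field_simps)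
  finally show ?thesis .
qed

lemma energy_le_of_vanishing:
  assumes f: "quasi f" and 0: "f 0 = 0"
  shows "energy f \<le> nrm f"
proof -
  have per: "(cmod (f (y + int m)))\<^sup>2 = (cmod (f y))\<^sup>2" for y
    using f by (simp add: quasiD norm_mult)
  have fm: "f (int m) = 0" using quasiD[OF f, of 0] 0 by simp
  have wf: "of_real (w y) * f y = f y" if "y \<in> {0..int m}" for y
    using that 0 fm w_1[of y] by (cases "y = 0 \<or> y = int m") auto
  have "energy f = (\<Sum>y\<in>{0..<int m}. (cmod ((f y + f (y + 1)) / 2))\<^sup>2)"
    unfolding energy_def D_def by (intro sum.cong refl) (auto simp: wf)
  also have "\<dots> \<le> (\<Sum>y\<in>{0..<int m}. ((cmod (f y))\<^sup>2 + (cmod (f (y + 1)))\<^sup>2) / 2)"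
    by (intro sum_mono cmod_avg_sq)
  also have "\<dots> = ((\<Sum>y\<in>{0..<int m}. (cmod (f y))\<^sup>2) + (\<Sum>y\<in>{0..<int m}. (cmod (f (y + 1)))\<^sup>2)) / 2"
    by (simp add: sum.distrib sum_divide_distrib add_divide_distrib)
  also have "\<dots> = (\<Sum>y\<in>{0..<int m}. (cmod (f y))\<^sup>2)"
    by (subst sum_shift[where F = "\<lambda>y. (cmod (f y))\<^sup>2"]) (simp_all add: per)
  also have "\<dots> = nrm f"
    unfolding nrm_def
  proof (intro sum.cong refl)
    fix y assume "y \<in> {0..<int m}"
    then show "(cmod (f y))\<^sup>2 = w y * (cmod (f y))\<^sup>2"
      using 0 w_1[of y] by (cases "y = 0") auto
  qed
  finally show ?thesis .
qed

end

subsection \<open>Contraction on the orthogonal complement\<close>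

text \<open>Interlacing: perturbing the lazy walk at the single site 0 produces at most one eigenvalue above 1,
  so the operator is a contraction on the orthogonal complement of such an eigenvector.\<close>
locale pinned_eigen = pinned_period +
  fixes h :: "int \<Rightarrow> complex" and L :: real
  assumes quasi_h: "quasi h" and A_h: "\<And>y. A h y = of_real L * h y" and L_gt: "L > 1" and h0: "h 0 \<noteq> 0"
begin

lemma ip_h_A: "quasi v \<Longrightarrow> ip h (A v) = L * ip h v"
  by (subst ip_A_sym[symmetric]) (simp_all add: quasi_h ip_def A_h sum_distrib_left mult_ac)

lemma nrm_h_pos: "nrm h > 0"
proof -
  have "0 < w 0 * (cmod (h 0))\<^sup>2" using h0 w_pos by simp
  also have "\<dots> \<le> nrm h"
    unfolding nrm_def using w_pos m_pos
    by (intro member_le_sum) (auto intro!: mult_nonneg_nonneg less_imp_le[OF w_pos])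
  finally show ?thesis .
qed

lemma energy_le_of_orthogonal:
  assumes v: "quasi v" and orth: "ip h v = 0"
  shows "energy v \<le> nrm v"
proof -
  have "of_real (energy h) = complex_of_real (L * nrm h)"
    unfolding ip_A_self[OF quasi_h, symmetric] ip_h_A[OF quasi_h] ip_self by simp
  then have Eh: "energy h = L * nrm h" by (simp only: of_real_eq_iff)
  let ?f = "\<lambda>y. v 0 * h y - h 0 * v y"
  have "energy ?f \<le> nrm ?f"
    by (rule energy_le_of_vanishing[OF quasi_lin[OF quasi_h v]]) simp
  then have "(cmod (v 0))\<^sup>2 * (L * nrm h) + (cmod (h 0))\<^sup>2 * energy v
     \<le> (cmod (v 0))\<^sup>2 * nrm h + (cmod (h 0))\<^sup>2 * nrm v"
    using orth by (simp add: energy_lin[OF quasi_h v] nrm_lin ip_h_A[OF v] Eh)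
  moreover have "(cmod (v 0))\<^sup>2 * nrm h \<le> (cmod (v 0))\<^sup>2 * (L * nrm h)"
    using L_gt nrm_h_pos by (intro mult_left_mono) auto
  ultimately have "(cmod (h 0))\<^sup>2 * energy v \<le> (cmod (h 0))\<^sup>2 * nrm v" by linarith
  then show ?thesis using h0 by simp
qed

lemma nrm_A_le:
  assumes v: "quasi v" and orth: "ip h v = 0"
  shows "nrm (A v) \<le> nrm v"
proof -
  have "of_real (nrm (A v)) = ip (A v) (A v)" by (simp add: ip_self)
  also have "\<dots> = (\<Sum>y\<in>{0..<int m}. cnj (D (A v) y) * D v y)"
    by (rule ip_A[OF quasi_A[OF v] v])
  finally have "nrm (A v) = (\<Sum>y\<in>{0..<int m}. Re (cnj (D (A v) y) * D v y))"
    by (metis Re_complex_of_real Re_sum)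
  also have "\<dots> \<le> (\<Sum>y\<in>{0..<int m}. ((cmod (D (A v) y))\<^sup>2 + (cmod (D v y))\<^sup>2) / 2)"
  proof (rule sum_mono)
    fix y
    have "Re (cnj (D (A v) y) * D v y) \<le> cmod (D (A v) y) * cmod (D v y)"
      using complex_Re_le_cmod[of "cnj (D (A v) y) * D v y"] by (simp only: norm_mult complex_mod_cnj)
    also have "\<dots> \<le> ((cmod (D (A v) y))\<^sup>2 + (cmod (D v y))\<^sup>2) / 2"
      using zero_le_power2[of "cmod (D (A v) y) - cmod (D v y)"] by (simp add: power2_eq_square field_simps)
    finally show "Re (cnj (D (A v) y) * D v y) \<le> ((cmod (D (A v) y))\<^sup>2 + (cmod (D v y))\<^sup>2) / 2" .
  qed
  also have "\<dots> = (energy (A v) + energy v) / 2"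
    by (simp add: energy_def sum.distrib sum_divide_distrib add_divide_distrib)
  also have "\<dots> \<le> (nrm (A v) + nrm v) / 2"
    using energy_le_of_orthogonal[OF v orth] energy_le_of_orthogonal[OF quasi_A[OF v]] ip_h_A[OF v] orth by simp
  finally show ?thesis by simp
qed

lemma nrm_funpow_A_le:
  assumes "quasi v" "ip h v = 0"
  shows "quasi ((A ^^ n) v) \<and> ip h ((A ^^ n) v) = 0 \<and> nrm ((A ^^ n) v) \<le> nrm v"
  by (induction n) (use assms nrm_A_le ip_h_A quasi_A order_trans in \<open>auto, fastforce\<close>)

lemma funpow_A_h: "(A ^^ n) h y = L ^ n * h y"
proof (induction n arbitrary: y)
  case (Suc n)
  have "(A ^^ n) h = (\<lambda>y. of_real (L ^ n) * h y - 0 * h y)"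
    using Suc by auto
  then have "(A ^^ Suc n) h y = A (\<lambda>y. of_real (L ^ n) * h y - 0 * h y) y"
    by simp
  also have "\<dots> = L ^ Suc n * h y"
    unfolding pinned_lazy_step_lin by (simp add: A_h)
  finally show ?case .
qed simp

lemma funpow_A_approx:
  assumes g: "quasi g"
  shows "cmod ((A ^^ n) g 0 - L ^ n * (h 0 * ip h g / ip h h)) \<le> sqrt (nrm g / exp \<delta>)"
proof -
  define \<alpha> where "\<alpha> = ip h g / ip h h"
  define v where "v = (\<lambda>y. 1 * g y - \<alpha> * h y)"
  have hh: "ip h h \<noteq> 0" using nrm_h_pos by (simp add: ip_self)
  have v: "quasi v" unfolding v_def by (rule quasi_lin[OF g quasi_h])
  have "ip h v = ip h g - \<alpha> * ip h h"
    unfolding v_def ip_def by (simp add: sum_subtractf sum_distrib_left algebra_simps)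
  then have orth: "ip h v = 0" using hh by (simp add: \<alpha>_def)
  have "nrm (\<lambda>y. \<alpha> * h y - (-1) * v y) = (cmod \<alpha>)\<^sup>2 * nrm h + nrm v"
    unfolding nrm_lin using orth by simp
  moreover have "(\<lambda>y. \<alpha> * h y - (-1) * v y) = g" by (auto simp: v_def)
  ultimately have ng: "nrm v \<le> nrm g" using nrm_h_pos by simp
  have eq: "(A ^^ n) v 0 = (A ^^ n) g 0 - L ^ n * (h 0 * \<alpha>)"
    unfolding v_def funpow_pinned_lazy_step_lin by (simp add: funpow_A_h)
  have "exp \<delta> * (cmod ((A ^^ n) v 0))\<^sup>2 = w 0 * (cmod ((A ^^ n) v 0))\<^sup>2" by (simp add: w_0)
  also have "\<dots> \<le> nrm ((A ^^ n) v)"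
    unfolding nrm_def using m_pos by (intro member_le_sum) (auto intro!: mult_nonneg_nonneg less_imp_le[OF w_pos])
  also have "\<dots> \<le> nrm g" using nrm_funpow_A_le[OF v orth, of n] ng by simp
  finally have "(cmod ((A ^^ n) v 0))\<^sup>2 \<le> nrm g / exp \<delta>" by (simp add: field_simps)
  then have "cmod ((A ^^ n) v 0) \<le> sqrt (nrm g / exp \<delta>)" by (rule real_le_rsqrt)
  then show ?thesis by (simp add: eq \<alpha>_def)
qed

end

subsection \<open>The explicit eigenvector\<close>

locale pinned_root = pinned_period +
  fixes r :: real
  assumes r_pos: "r > 0" and r_lt_1: "r < 1"
    and root: "(1 - r) * (1 + (r ^ m)\<^sup>2 - 2 * r ^ m * cos u) = (1 - exp (-\<delta>)) * (1 + r) * (1 - (r ^ m)\<^sup>2)"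
begin

abbreviation \<rho> :: real where "\<rho> \<equiv> r ^ m"
abbreviation L :: real where "L \<equiv> (1 + r)\<^sup>2 / (4 * r)"

text \<open>The combination of the two exponential solutions of the unperturbed eigenvalue equation that
  gains exactly the factor \<^term>\<open>cis u\<close> over one period.\<close>
definition profile :: "nat \<Rightarrow> complex" where
  "profile j = (1 - cis u * of_real \<rho>) * of_real (r ^ j) + (cis u - of_real \<rho>) * of_real (r ^ (m - j))"

definition F :: "int \<Rightarrow> complex" where
  "F y = cis (u * real_of_int (y div int m)) * profile (nat (y mod int m))"

definition h :: "int \<Rightarrow> complex" where "h y = F y / of_real (w y)"

lemma profile_0: "profile 0 = of_real (1 - \<rho>\<^sup>2)"
  by (simp add: profile_def algebra_simps power2_eq_square)

lemma profile_m: "profile m = cis u * of_real (1 - \<rho>\<^sup>2)"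
  by (simp add: profile_def algebra_simps power2_eq_square)

lemma F_shift: "F (y + int m) = cis u * F y"
  using m_pos by (simp add: F_def cis_mult ring_distribs add_ac)

lemma F_of_nat: "j \<le> m \<Longrightarrow> F (int j) = profile j"
proof (cases "j = m")
  case True
  then show ?thesis using m_pos by (simp add: F_def profile_m profile_0)
next
  case False
  moreover assume "j \<le> m"
  ultimately show ?thesis by (simp add: F_def)
qed

lemma F_0: "F 0 = of_real (1 - \<rho>\<^sup>2)"
  using F_of_nat[of 0] profile_0 by simp

lemma quasi_h: "quasi h"
  unfolding quasi_def h_def w_period F_shift by simp

lemma w_h: "of_real (w y) * h y = F y"
  using w_pos[of y] by (simp add: h_def)

lemma h_0: "h 0 = of_real (exp (-\<delta>) * (1 - \<rho>\<^sup>2))"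
  by (simp add: h_def F_0 w_0 exp_minus field_simps)

lemma \<rho>_pos: "\<rho> > 0" using r_pos by simp
lemma \<rho>_lt_1: "\<rho> < 1" using r_pos r_lt_1 m_pos by (simp add: power_less_one_iff)
lemma \<rho>_sq_lt_1: "\<rho>\<^sup>2 < 1"
  using \<rho>_pos \<rho>_lt_1 by (simp add: power_less_one_iff)

lemma L_gt_1: "L > 1"
proof -
  have "0 < (1 - r)\<^sup>2" using r_lt_1 by simp
  then show ?thesis using r_pos by (simp add: field_simps power2_eq_square)
qed

lemma profile_interior:
  assumes "m = j + 2 + k"
  shows "profile (j + 2) + 2 * profile (j + 1) + profile j = 4 * of_real L * profile (j + 1)"
proof -
  have e: "m - (j + 2) = k" "m - (j + 1) = k + 1" "m - j = k + 2" using assms by auto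
  have "4 * of_real L = complex_of_real (1 + r) ^ 2 / of_real r"
    using r_pos by simp
  then show ?thesis
    unfolding profile_def e using r_pos by (simp add: field_simps power2_eq_square)
qed

lemma profile_boundary:
  assumes "m = Suc k"
  shows "profile 1 + 2 * profile 0 + cis (-u) * profile k = 4 * of_real L * of_real (exp (-\<delta>)) * profile 0"
proof -
  have \<rho>: "\<rho> = r * r ^ k" using assms by simp
  have cc: "cis (-u) * cis u = 1" by (simp add: cis_mult)
  have cs: "cis u + cis (-u) = 2 * of_real (cos u)" by (simp add: complex_eq_iff)
  have e: "m - 1 = k" "m - k = 1" using assms by auto
  have "profile 1 + 2 * profile 0 + cis (-u) * profile k
     = of_real r * (2 - of_real \<rho> * (cis u + cis (-u))) + of_real (r ^ k) * ((cis u + cis (-u)) - 2 * of_real \<rho>)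
       + 2 * of_real (1 - \<rho>\<^sup>2) + (cis (-u) * cis u - 1) * (of_real r - of_real \<rho> * of_real (r ^ k))"
    unfolding profile_0 unfolding profile_def e by (simp add: algebra_simps)
  also have "\<dots> = of_real (r * (2 - 2 * \<rho> * cos u) + r ^ k * (2 * cos u - 2 * \<rho>) + 2 * (1 - \<rho>\<^sup>2))"
    unfolding cc cs by simp
  also have "r * (2 - 2 * \<rho> * cos u) + r ^ k * (2 * cos u - 2 * \<rho>) + 2 * (1 - \<rho>\<^sup>2)
      = 4 * L * exp (-\<delta>) * (1 - \<rho>\<^sup>2)"
  proof -
    have "r * (r * (2 - 2 * \<rho> * cos u) + r ^ k * (2 * cos u - 2 * \<rho>) + 2 * (1 - \<rho>\<^sup>2))
       = 2 * r\<^sup>2 * (1 - \<rho> * cos u) + 2 * \<rho> * (cos u - \<rho>) + 2 * r * (1 - \<rho>\<^sup>2)"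
      unfolding \<rho> by (simp add: algebra_simps power2_eq_square)
    also have "\<dots> = (1 + r)\<^sup>2 * (1 - \<rho>\<^sup>2) - (1 + r) * ((1 - r) * (1 + \<rho>\<^sup>2 - 2 * \<rho> * cos u))"
      by (simp add: algebra_simps power2_eq_square)
    also have "\<dots> = (1 + r)\<^sup>2 * exp (-\<delta>) * (1 - \<rho>\<^sup>2)"
      unfolding root by (simp add: algebra_simps power2_eq_square)
    also have "\<dots> = r * (4 * L * exp (-\<delta>) * (1 - \<rho>\<^sup>2))" using r_pos by simp
    finally show ?thesis using r_pos mult_left_cancel[of r] by blast
  qed
  finally show ?thesis unfolding profile_0 by simp
qed

lemma A_h_period:
  assumes "0 \<le> y" "y < int m"
  shows "A h y = of_real L * h y"
proof -
  have *: "A h y = (F (y + 1) + 2 * F y + F (y - 1)) / 4"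
    unfolding pinned_lazy_step_def mult.assoc w_h by simp
  show ?thesis
  proof (cases "y = 0")
    case True
    obtain k where k: "m = Suc k" using m_pos by (cases m) auto
    have "F (-1) = cis (-u) * (cis u * F (-1))" by (simp add: cis_mult flip: mult.assoc)
    also have "cis u * F (-1) = F (int k)" using F_shift[of "-1"] k by simp
    finally have "F (-1) = cis (-u) * profile k" using F_of_nat[of k] k by simp
    moreover have "F 1 = profile 1" using F_of_nat[of 1] m_pos by simp
    moreover have "F 0 = profile 0" using F_of_nat[of 0] by simp
    ultimately have "A h y = (profile 1 + 2 * profile 0 + cis (-u) * profile k) / 4"
      using * True by simp
    also have "\<dots> = of_real L * h 0"
      by (subst profile_boundary[OF k]) (simp add: profile_0 h_0 mult_ac)
    finally show ?thesis by (simp add: True)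
  next
    case False
    define j where "j = nat y - 1"
    define k where "k = m - nat y - 1"
    have jk: "m = j + 2 + k" "y = int (j + 1)" using assms False by (auto simp: j_def k_def)
    have "F (y + 1) = profile (j + 2)" "F y = profile (j + 1)" "F (y - 1) = profile j"
      using F_of_nat[of "j + 2"] F_of_nat[of "j + 1"] F_of_nat[of j] jk by (auto simp: add_ac)
    then have "A h y = of_real L * F y"
      unfolding * using profile_interior[OF jk(1)] by (simp add: add_ac)
    moreover have "h y = F y" using assms False w_1[of y] by (simp add: h_def)
    ultimately show ?thesis by simp
  qed
qed

lemma A_h: "A h y = of_real L * h y"
proof -
  define P where "P y \<longleftrightarrow> A h y = of_real L * h y" for y
  have step: "P (y + int m) \<longleftrightarrow> P y" for y
    unfolding P_def quasiD[OF quasi_A[OF quasi_h]] quasiD[OF quasi_h]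
    by (simp only: mult.left_commute[of _ "cis u"] mult_cancel_left cis_neq_zero simp_thms)
  have steps: "P (y + int (k * m)) \<longleftrightarrow> P y" for y k
  proof (induction k)
    case (Suc k)
    then show ?case using step[of "y + int (k * m)"] by (simp add: algebra_simps)
  qed simp
  have base: "P (y mod int m)" using A_h_period[of "y mod int m"] m_pos by (simp add: P_def)
  have "P y"
  proof (cases "y div int m \<ge> 0")
    case True
    then have "y = y mod int m + int (nat (y div int m) * m)" by (simp add: mult.commute)
    then show ?thesis using steps base by metis
  next
    case False
    then have "y + int (nat (- (y div int m)) * m) = y mod int m"
      by (simp add: minus_div_mult_eq_mod)
    then show ?thesis using steps base by metis
  qed
  then show ?thesis by (simp add: P_def)
qed

lemma h_0_nonzero: "h 0 \<noteq> 0"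
  using \<rho>_sq_lt_1 by (simp add: h_0 del: of_real_mult of_real_diff)

end

sublocale pinned_root \<subseteq> pinned_eigen m \<delta> u h L
  by unfold_locales (use quasi_h A_h L_gt_1 h_0_nonzero in auto)

context pinned_root
begin

abbreviation wave :: "int \<Rightarrow> complex" where "wave \<equiv> plane_wave m u"

lemma quasi_wave: "quasi wave"
  using m_pos by (simp add: quasi_def plane_wave_def cis_mult add_divide_distrib ring_distribs add.commute)

lemma cmod_wave: "cmod (wave y) = 1" by (simp add: plane_wave_def)

lemma inverse_w: "y \<in> {0..<int m} \<Longrightarrow> 1 / w y = 1 - (if y = 0 then 1 - exp (-\<delta>) else 0)"
  using w_1[of y] by (auto simp: w_0 exp_minus field_simps)

lemma sum_over_w:
  fixes G :: "int \<Rightarrow> complex"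
  shows "(\<Sum>y\<in>{0..<int m}. G y / of_real (w y)) = (\<Sum>y\<in>{0..<int m}. G y) - of_real (1 - exp (-\<delta>)) * G 0"
proof -
  have "(\<Sum>y\<in>{0..<int m}. G y / of_real (w y))
      = (\<Sum>y\<in>{0..<int m}. G y - (if y = 0 then of_real (1 - exp (-\<delta>)) * G y else 0))"
  proof (intro sum.cong refl)
    fix y assume y: "y \<in> {0..<int m}"
    have "G y / of_real (w y) = of_real (1 / w y) * G y" by simp
    also have "\<dots> = G y - (if y = 0 then of_real (1 - exp (-\<delta>)) * G y else 0)"
      unfolding inverse_w[OF y] by (simp add: algebra_simps)
    finally show "G y / of_real (w y) = G y - (if y = 0 then of_real (1 - exp (-\<delta>)) * G y else 0)" .
  qed
  also have "\<dots> = (\<Sum>y\<in>{0..<int m}. G y) - of_real (1 - exp (-\<delta>)) * G 0"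
    unfolding sum_subtractf using m_pos by (simp add: sum.delta)
  finally show ?thesis .
qed

lemma ip_h: "ip h g = (\<Sum>y\<in>{0..<int m}. cnj (F y) * g y)"
  unfolding ip_def using w_pos by (intro sum.cong refl) (simp add: h_def less_imp_neq[symmetric])

text \<open>The plane wave is an eigenfunction of the unperturbed lazy walk, so self-adjointness determines
  its overlap with the eigenvector from the value at the single site 0.\<close>
lemma ip_h_wave: "ip h wave = of_real (L * (1 - exp (-\<delta>)) * (1 - \<rho>\<^sup>2) / (L - (cos (u / (2 * real m)))\<^sup>2))"
proof -
  define c where "c = cos (u / (2 * real m))"
  define l where "l = L"
  define g where "g = (\<lambda>y. wave y / of_real (w y))"
  have wg: "of_real (w y) * g y = wave y" for y using w_pos[of y] by (simp add: g_def)
  have qg: "quasi g" using quasi_wave by (simp add: quasi_def g_def w_period)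
  have Ag: "A g y = of_real (c\<^sup>2) * wave y" for y
  proof -
    define e where "e = cis (u / real m)"
    have "wave (y + 1) = e * wave y" "wave (y - 1) = cnj e * wave y"
      by (simp_all add: plane_wave_def e_def cis_mult cis_cnj add_divide_distrib diff_divide_distrib ring_distribs add.commute)
    then have "A g y = ((e + cnj e + 2) / 4) * wave y"
      unfolding pinned_lazy_step_def mult.assoc wg by (simp add: algebra_simps)
    also have "(e + cnj e + 2) / 4 = of_real (c\<^sup>2)"
    proof -
      have "cos (u / real m) = 2 * c\<^sup>2 - 1"
        using cos_double_cos[of "u / (2 * real m)"] by (simp add: c_def)
      then show ?thesis by (simp add: e_def complex_eq_iff)
    qed
    finally show ?thesis .
  qed
  have "of_real (c\<^sup>2) * ip h wave = ip h (A g)"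
    by (simp add: ip_h Ag sum_distrib_left mult_ac)
  also have "\<dots> = of_real l * ip h g" unfolding l_def by (rule ip_h_A[OF qg])
  also have "ip h g = (\<Sum>y\<in>{0..<int m}. cnj (F y) * wave y / of_real (w y))"
    by (simp add: ip_h g_def)
  also have "\<dots> = ip h wave - of_real (1 - exp (-\<delta>)) * of_real (1 - \<rho>\<^sup>2)"
    unfolding sum_over_w[of "\<lambda>y. cnj (F y) * wave y"] F_0 by (simp add: ip_h plane_wave_def)
  finally have "of_real (l - c\<^sup>2) * ip h wave = of_real (l * (1 - exp (-\<delta>)) * (1 - \<rho>\<^sup>2))"
    by (simp add: algebra_simps)
  moreover have "l - c\<^sup>2 > 0"
    using L_gt_1[folded l_def] abs_cos_le_one[of "u / (2 * real m)"] abs_square_le_1[of c] by (simp add: c_def)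
  ultimately show ?thesis unfolding c_def[symmetric] l_def[symmetric] of_real_divide
    by (metis (no_types, lifting) less_irrefl nonzero_mult_div_cancel_left of_real_eq_0_iff)
qed

definition profile_norm :: real where
  "profile_norm = (1 + \<rho>\<^sup>2 - 2 * \<rho> * cos u) * (1 + r\<^sup>2) * ((1 - \<rho>\<^sup>2) / (1 - r\<^sup>2))
     + 2 * real m * \<rho> * (cos u * (1 + \<rho>\<^sup>2) - 2 * \<rho>)"

lemma cmod_profile_sq:
  assumes "j \<le> m"
  shows "(cmod (profile j))\<^sup>2 = (1 + \<rho>\<^sup>2 - 2 * \<rho> * cos u) * ((r\<^sup>2) ^ j + (r\<^sup>2) ^ (m - j))
     + 2 * \<rho> * (cos u * (1 + \<rho>\<^sup>2) - 2 * \<rho>)"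
proof -
  define p where "p = r ^ j"
  define q where "q = r ^ (m - j)"
  have pq: "\<rho> = p * q" using assms by (simp add: p_def q_def flip: power_add)
  have sq: "(r\<^sup>2) ^ j = p\<^sup>2" "(r\<^sup>2) ^ (m - j) = q\<^sup>2" by (simp_all add: p_def q_def mult.commute flip: power_mult)
  have cs: "(sin u)\<^sup>2 = 1 - (cos u)\<^sup>2" by (simp add: sin_squared_eq)
  have "(cmod (profile j))\<^sup>2 = ((1 - cos u * \<rho>) * p + (cos u - \<rho>) * q)\<^sup>2 + (sin u * (q - \<rho> * p))\<^sup>2"
    unfolding cmod_power2 profile_def p_def[symmetric] q_def[symmetric] by (simp add: algebra_simps)
  also have "\<dots> = ((1 - cos u * \<rho>) * p + (cos u - \<rho>) * q)\<^sup>2 + (1 - (cos u)\<^sup>2) * (q - \<rho> * p)\<^sup>2"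
    unfolding power_mult_distrib cs ..
  also have "\<dots> = (1 + \<rho>\<^sup>2 - 2 * \<rho> * cos u) * (p\<^sup>2 + q\<^sup>2) + 2 * (p * q) * (cos u * (1 + \<rho>\<^sup>2) - 2 * \<rho>)"
    by (simp add: algebra_simps power2_eq_square)
  finally show ?thesis unfolding sq pq[symmetric] .
qed

lemma sum_profile: "(\<Sum>y\<in>{0..<int m}. (cmod (F y))\<^sup>2) = profile_norm"
proof -
  have r2: "r\<^sup>2 \<noteq> 1" using r_pos r_lt_1 by (auto simp: power2_eq_1_iff power_less_one_iff)
  define X where "X = (1 - \<rho>\<^sup>2) / (1 - r\<^sup>2)"
  have \<rho>2: "(r\<^sup>2) ^ m = \<rho>\<^sup>2" by (simp add: mult.commute flip: power_mult)
  have "(\<Sum>y\<in>{0..<int m}. (cmod (F y))\<^sup>2) = (\<Sum>j<m. (cmod (profile j))\<^sup>2)"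
    by (rule sum.reindex_bij_witness[of _ int nat]) (auto simp: F_of_nat[symmetric])
  also have "\<dots> = (\<Sum>j<m. (1 + \<rho>\<^sup>2 - 2 * \<rho> * cos u) * ((r\<^sup>2) ^ j + (r\<^sup>2) ^ (m - j))
     + 2 * \<rho> * (cos u * (1 + \<rho>\<^sup>2) - 2 * \<rho>))"
    by (intro sum.cong refl cmod_profile_sq) simp
  also have "\<dots> = (1 + \<rho>\<^sup>2 - 2 * \<rho> * cos u) * ((\<Sum>j<m. (r\<^sup>2) ^ j) + (\<Sum>j<m. (r\<^sup>2) ^ (m - j)))
     + real m * (2 * \<rho> * (cos u * (1 + \<rho>\<^sup>2) - 2 * \<rho>))"
    by (simp add: sum.distrib sum_distrib_left[symmetric])
  also have "(\<Sum>j<m. (r\<^sup>2) ^ (m - j)) = (\<Sum>j<m. r\<^sup>2 * (r\<^sup>2) ^ j)"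
  proof (rule sum.reindex_bij_witness[of _ "\<lambda>j. m - Suc j" "\<lambda>j. m - Suc j"])
    fix j assume "j \<in> {..<m}"
    then have "m - j = Suc (m - Suc j)" by simp
    then show "r\<^sup>2 * (r\<^sup>2) ^ (m - Suc j) = (r\<^sup>2) ^ (m - j)" by (simp only: power_Suc)
  qed auto
  also have "\<dots> = r\<^sup>2 * (\<Sum>j<m. (r\<^sup>2) ^ j)" by (simp add: sum_distrib_left)
  also have "(\<Sum>j<m. (r\<^sup>2) ^ j) = X"
    using geometric_sum[OF r2, of m] unfolding \<rho>2 X_def
    by (metis minus_diff_eq minus_divide_divide)
  finally show ?thesis unfolding profile_norm_def X_def[symmetric] by (simp add: algebra_simps)
qed

lemma ip_h_h: "ip h h = of_real (profile_norm - (1 - exp (-\<delta>)) * (1 - \<rho>\<^sup>2)\<^sup>2)"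
proof -
  have "ip h h = (\<Sum>y\<in>{0..<int m}. of_real ((cmod (F y))\<^sup>2) / of_real (w y))"
    unfolding ip_h by (intro sum.cong refl) (simp add: h_def complex_norm_square mult.commute del: of_real_power)
  also have "\<dots> = of_real (\<Sum>y\<in>{0..<int m}. (cmod (F y))\<^sup>2) - of_real (1 - exp (-\<delta>)) * of_real ((cmod (F 0))\<^sup>2)"
    by (simp only: sum_over_w of_real_sum)
  also have "(cmod (F 0))\<^sup>2 = (1 - \<rho>\<^sup>2)\<^sup>2" unfolding F_0 norm_of_real by simp
  finally show ?thesis unfolding sum_profile by simp
qed

definition amplitude :: real where
  "amplitude = exp (-\<delta>) * (1 - \<rho>\<^sup>2) * (L * (1 - exp (-\<delta>)) * (1 - \<rho>\<^sup>2) / (L - (cos (u / (2 * real m)))\<^sup>2))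
     / (profile_norm - (1 - exp (-\<delta>)) * (1 - \<rho>\<^sup>2)\<^sup>2)"

lemma nrm_wave: "nrm wave \<le> real m * exp \<delta>"
proof -
  have "nrm wave \<le> (\<Sum>y\<in>{0..<int m}. exp \<delta>)"
    unfolding nrm_def cmod_wave using \<delta>_pos by (intro sum_mono) (simp add: site_weight_def)
  then show ?thesis by simp
qed

lemma funpow_A_wave: "cmod ((A ^^ n) wave 0 - of_real (L ^ n * amplitude)) \<le> sqrt (real m)"
proof -
  have "cmod ((A ^^ n) wave 0 - L ^ n * (h 0 * ip h wave / ip h h)) \<le> sqrt (nrm wave / exp \<delta>)"
    by (rule funpow_A_approx[OF quasi_wave])
  also have "\<dots> \<le> sqrt (real m)" using nrm_wave by (simp add: field_simps)
  also have "L ^ n * (h 0 * ip h wave / ip h h) = of_real (L ^ n * amplitude)"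
    unfolding h_0 ip_h_wave ip_h_h amplitude_def by (simp only: of_real_mult of_real_divide)
  finally show ?thesis .
qed

end

subsection \<open>Asymptotics of the top eigenvalue\<close>

lemma tendsto_power_exp:
  fixes z :: "'a \<Rightarrow> real" and n :: "'a \<Rightarrow> nat"
  assumes nz: "((\<lambda>k. real (n k) * z k) \<longlongrightarrow> l) F" and z: "(z \<longlongrightarrow> 0) F"
  shows "((\<lambda>k. (1 + z k) ^ n k) \<longlongrightarrow> exp l) F"
proof -
  have small: "\<forall>\<^sub>F k in F. \<bar>z k\<bar> < 1/2"
    using tendstoD[OF z, of "1/2"] by (simp add: dist_real_def)
  have "((\<lambda>k. real (n k) * ln (1 + z k) - real (n k) * z k) \<longlongrightarrow> 0) F"
  proof (rule Lim_null_comparison)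
    show "\<forall>\<^sub>F k in F. norm (real (n k) * ln (1 + z k) - real (n k) * z k) \<le> 2 * \<bar>real (n k) * z k\<bar> * \<bar>z k\<bar>"
      using small
    proof eventually_elim
      case (elim k)
      have "norm (real (n k) * ln (1 + z k) - real (n k) * z k) = real (n k) * \<bar>ln (1 + z k) - z k\<bar>"
        by (simp add: abs_mult right_diff_distrib[symmetric])
      also have "\<dots> \<le> real (n k) * (2 * (z k)\<^sup>2)"
        using elim by (intro mult_left_mono abs_ln_one_plus_x_minus_x_bound) auto
      also have "\<dots> = 2 * \<bar>real (n k) * z k\<bar> * \<bar>z k\<bar>"
        unfolding abs_mult power2_abs[of "z k", symmetric] power2_eq_square by simp
      finally show ?case .
    qed
    show "((\<lambda>k. 2 * \<bar>real (n k) * z k\<bar> * \<bar>z k\<bar>) \<longlongrightarrow> 0) F"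
      by (rule tendsto_eq_intros nz z refl)+ simp
  qed
  from tendsto_add[OF this nz] have "((\<lambda>k. real (n k) * ln (1 + z k)) \<longlongrightarrow> l) F" by simp
  then have "((\<lambda>k. exp (real (n k) * ln (1 + z k))) \<longlongrightarrow> exp l) F" by (intro tendsto_intros)
  moreover have "\<forall>\<^sub>F k in F. exp (real (n k) * ln (1 + z k)) = (1 + z k) ^ n k"
    using small by eventually_elim (simp add: exp_of_nat_mult)
  ultimately show ?thesis by (rule Lim_transform_eventually)
qed

lemma exp_c_delta:
  assumes "\<delta> > 0"
  shows "exp (-2 * c_delta \<delta>) = exp (-\<delta>) / (2 - exp (-\<delta>))"
proof -
  have pos: "2 - exp (-\<delta>) > 0" using assms by (simp add: less_trans[of _ 1 2])
  have "-2 * c_delta \<delta> = -\<delta> - ln (2 - exp (-\<delta>))"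
    using pos by (simp add: c_delta_def ln_sqrt)
  then show ?thesis using pos by (simp add: exp_diff)
qed

lemma exp_c_delta_bounds:
  assumes "\<delta> > 0"
  shows "0 < exp (-2 * c_delta \<delta>)" "exp (-2 * c_delta \<delta>) < 1"
    and "1 - exp (-\<delta>) = (1 - exp (-2 * c_delta \<delta>)) / (1 + exp (-2 * c_delta \<delta>))"
proof -
  define x where "x = exp (-\<delta>)"
  have x: "0 < x" "x < 1" using assms by (auto simp: x_def)
  show "0 < exp (-2 * c_delta \<delta>)" by simp
  show "exp (-2 * c_delta \<delta>) < 1" unfolding exp_c_delta[OF assms] x_def[symmetric] using x by simp
  show "1 - exp (-\<delta>) = (1 - exp (-2 * c_delta \<delta>)) / (1 + exp (-2 * c_delta \<delta>))"
    unfolding exp_c_delta[OF assms] x_def[symmetric] using x by (simp add: field_simps)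
qed

lemma pinned_root_asymptotics:
  fixes \<delta> u :: real
  assumes \<delta>: "\<delta> > 0"
  defines "b \<equiv> exp (-2 * c_delta \<delta>)"
  obtains R :: "nat \<Rightarrow> real" where
    "\<forall>\<^sub>F m in sequentially. pinned_root m \<delta> u (R m)" "R \<longlonglongrightarrow> b"
    "(\<lambda>m. real m * R m ^ m) \<longlonglongrightarrow> 0" "(\<lambda>m. (b - R m) / b ^ m) \<longlonglongrightarrow> (1 - b\<^sup>2) * cos u"
proof -
  define a where "a = 1 - exp (-\<delta>)"
  have b: "0 < b" "b < 1" and ab: "a = (1 - b) / (1 + b)"
    unfolding b_def a_def by (intro exp_c_delta_bounds[OF \<delta>])+
  have a: "0 < a" "a < 1" using \<delta> by (auto simp: a_def)
  have a1: "1 + a = 2 / (1 + b)" using b by (simp add: ab field_simps)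
  have lin: "(1 - x) - a * (1 + x) = (1 + a) * (b - x)" for x
    using b by (simp add: ab field_simps)
  define p where "p m x = (1 - x) * (1 + (x ^ m)\<^sup>2 - 2 * x ^ m * cos u) - a * (1 + x) * (1 - (x ^ m)\<^sup>2)" for m x
  have lim_p: "(\<lambda>m. p m x) \<longlonglongrightarrow> (1 + a) * (b - x)" if "0 < x" "x < 1" for x
  proof -
    define P where "P m = x ^ m" for m
    have "P \<longlonglongrightarrow> 0" unfolding P_def using that by (intro LIMSEQ_realpow_zero) auto
    then have "(\<lambda>m. p m x) \<longlonglongrightarrow> (1 - x) * (1 + 0\<^sup>2 - 2 * 0 * cos u) - a * (1 + x) * (1 - 0\<^sup>2)"
      unfolding p_def P_def[symmetric] by (intro tendsto_intros)
    then show ?thesis using lin[of x] by simp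
  qed
  define s where "s = (1 + b) / 2"
  have s: "b < s" "s < 1" "0 < s" using b by (auto simp: s_def)
  have ev1: "\<forall>\<^sub>F m in sequentially. p m (b / 2) > 0"
    using b a by (intro order_tendstoD(1)[OF lim_p]) auto
  have ev2: "\<forall>\<^sub>F m in sequentially. p m s < 0"
    using b a s by (intro order_tendstoD(2)[OF lim_p]) (auto intro: mult_pos_neg)
  have ex: "\<forall>\<^sub>F m in sequentially. \<exists>x. b / 2 \<le> x \<and> x \<le> s \<and> p m x = 0"
    using ev1 ev2
  proof eventually_elim
    case (elim m)
    have "continuous_on {b / 2..s} (p m)" unfolding p_def by (intro continuous_intros)
    then show ?case using IVT2'[of "p m" s 0 "b / 2"] elim s b by auto
  qed
  define R where "R m = (SOME x. b / 2 \<le> x \<and> x \<le> s \<and> p m x = 0)" for m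
  have R: "\<forall>\<^sub>F m in sequentially. b / 2 \<le> R m \<and> R m \<le> s \<and> p m (R m) = 0"
    using ex by eventually_elim (unfold R_def, rule someI_ex)
  have root: "\<forall>\<^sub>F m in sequentially. pinned_root m \<delta> u (R m)"
    using R eventually_gt_at_top[of 0]
  proof eventually_elim
    case (elim m)
    then show ?case using b s \<delta> by unfold_locales (auto simp: p_def a_def)
  qed
  have mR: "(\<lambda>m. real m * R m ^ m) \<longlonglongrightarrow> 0"
  proof (rule Lim_null_comparison)
    show "(\<lambda>m. real m * s ^ m) \<longlonglongrightarrow> 0" using s powser_times_n_limit_0[of s] by simp
    show "\<forall>\<^sub>F m in sequentially. norm (real m * R m ^ m) \<le> real m * s ^ m"
      using R by eventually_elim (use b in \<open>auto simp: abs_mult intro!: mult_left_mono power_mono\<close>)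
  qed
  have R_pow: "(\<lambda>m. R m ^ m) \<longlonglongrightarrow> 0"
  proof (rule Lim_null_comparison)
    show "(\<lambda>m. s ^ m) \<longlonglongrightarrow> 0" using s by (intro LIMSEQ_realpow_zero) auto
    show "\<forall>\<^sub>F m in sequentially. norm (R m ^ m) \<le> s ^ m"
      using R by eventually_elim (use b in \<open>auto simp: power_abs intro!: power_mono\<close>)
  qed
  define q where "q m = 2 * (1 - R m) * cos u - R m ^ m * ((1 - R m) + a * (1 + R m))" for m
  have id: "\<forall>\<^sub>F m in sequentially. (1 + a) * (b - R m) = R m ^ m * q m"
    using R
  proof eventually_elim
    case (elim m)
    then have "(1 - R m) - a * (1 + R m) = R m ^ m * q m"
      by (simp add: p_def q_def algebra_simps power2_eq_square)
    then show ?case by (simp add: lin)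
  qed
  have bound: "\<forall>\<^sub>F m in sequentially. \<bar>b - R m\<bar> \<le> 5 * R m ^ m"
    using R id
  proof eventually_elim
    case (elim m)
    have R01: "0 \<le> R m" "R m \<le> 1" using elim b s by auto
    have P01: "0 \<le> R m ^ m" "R m ^ m \<le> 1" using R01 by (auto simp: power_le_one)
    have "\<bar>q m\<bar> \<le> \<bar>2 * (1 - R m) * cos u\<bar> + \<bar>R m ^ m * ((1 - R m) + a * (1 + R m))\<bar>"
      unfolding q_def by (rule abs_triangle_ineq4)
    also have "\<bar>2 * (1 - R m) * cos u\<bar> \<le> 2 * 1"
      unfolding abs_mult using R01 by (intro mult_mono) (auto simp: abs_le_iff)
    also have "\<bar>R m ^ m * ((1 - R m) + a * (1 + R m))\<bar> \<le> 1 * 3"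
    proof -
      have "a * (1 + R m) \<le> 1 * 2" using R01 a by (intro mult_mono) auto
      moreover have "0 \<le> a * (1 + R m)" using R01 a by simp
      ultimately have "\<bar>(1 - R m) + a * (1 + R m)\<bar> \<le> 3" using R01 by linarith
      then show ?thesis unfolding abs_mult using P01 by (intro mult_mono) auto
    qed
    finally have q: "\<bar>q m\<bar> \<le> 5" by simp
    have "\<bar>b - R m\<bar> \<le> (1 + a) * \<bar>b - R m\<bar>" using a by (simp add: algebra_simps)
    also have "\<dots> = \<bar>(1 + a) * (b - R m)\<bar>" using a by (simp add: abs_mult)
    also have "\<dots> = R m ^ m * \<bar>q m\<bar>" unfolding elim(2) using P01 by (simp add: abs_mult)
    also have "\<dots> \<le> R m ^ m * 5" using q P01 by (intro mult_left_mono)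
    finally show ?case by simp
  qed
  have Rb: "R \<longlonglongrightarrow> b"
  proof -
    have "(\<lambda>m. b - R m) \<longlonglongrightarrow> 0"
      by (rule Lim_null_comparison[of _ "\<lambda>m. 5 * R m ^ m"]) (use bound R_pow in \<open>auto intro: tendsto_mult_right_zero\<close>)
    from tendsto_diff[OF tendsto_const[of b] this] show ?thesis by simp
  qed
  have ratio: "(\<lambda>m. (R m / b) ^ m) \<longlonglongrightarrow> 1"
  proof -
    have "(\<lambda>m. real m * ((R m - b) / b)) \<longlonglongrightarrow> 0"
    proof (rule Lim_null_comparison)
      show "\<forall>\<^sub>F m in sequentially. norm (real m * ((R m - b) / b)) \<le> (5 / b) * (real m * R m ^ m)"
        using bound
      proof eventually_elim
        case (elim m)
        have "norm (real m * ((R m - b) / b)) = real m / b * \<bar>b - R m\<bar>"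
          using b by (simp add: abs_mult abs_minus_commute)
        also have "\<dots> \<le> real m / b * (5 * R m ^ m)" using elim b by (intro mult_left_mono) auto
        finally show ?case by (simp add: mult_ac)
      qed
      show "(\<lambda>m. (5 / b) * (real m * R m ^ m)) \<longlonglongrightarrow> 0"
        using mR by (rule tendsto_mult_right_zero)
    qed
    moreover have "(\<lambda>m. (R m - b) / b) \<longlonglongrightarrow> (b - b) / b" using b by (intro tendsto_intros Rb) auto
    ultimately have "(\<lambda>m. (1 + (R m - b) / b) ^ m) \<longlonglongrightarrow> exp 0"
      by (intro tendsto_power_exp) auto
    moreover have "1 + (x - b) / b = x / b" for x using b by (simp add: field_simps)
    ultimately show ?thesis by simp
  qed
  have "(\<lambda>m. (R m / b) ^ m * q m / (1 + a)) \<longlonglongrightarrow> 1 * (2 * (1 - b) * cos u - 0 * ((1 - b) + a * (1 + b))) / (1 + a)"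
    unfolding q_def using a by (intro tendsto_intros ratio Rb R_pow) auto
  moreover have "1 * (2 * (1 - b) * cos u - 0 * ((1 - b) + a * (1 + b))) / (1 + a) = (1 - b\<^sup>2) * cos u"
    unfolding a1 using b by (simp add: field_simps power2_eq_square)
  moreover have "\<forall>\<^sub>F m in sequentially. (R m / b) ^ m * q m / (1 + a) = (b - R m) / b ^ m"
    using id
  proof eventually_elim
    case (elim m)
    have "(R m / b) ^ m * q m / (1 + a) = (R m ^ m * q m) / (1 + a) / b ^ m" by (simp add: power_divide)
    also have "\<dots> = (b - R m) / b ^ m" unfolding elim[symmetric] using a by simp
    finally show ?case .
  qed
  ultimately have "(\<lambda>m. (b - R m) / b ^ m) \<longlonglongrightarrow> (1 - b\<^sup>2) * cos u"
    using Lim_transform_eventually by fastforce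
  with root Rb mR show ?thesis by (rule that)
qed

definition limit_amplitude :: "real \<Rightarrow> real" where
  "limit_amplitude \<delta> = (let b = exp (-2 * c_delta \<delta>); l = (1 + b)\<^sup>2 / (4 * b) in
     exp (-\<delta>) * (l * (1 - exp (-\<delta>)) / (l - 1)) / ((1 + b\<^sup>2) / (1 - b\<^sup>2) - (1 - exp (-\<delta>))))"

lemma amplitude_limit:
  fixes \<delta> u :: real and R :: "nat \<Rightarrow> real"
  defines "b \<equiv> exp (-2 * c_delta \<delta>)"
  assumes \<delta>: "\<delta> > 0"
    and root: "\<forall>\<^sub>F m in sequentially. pinned_root m \<delta> u (R m)"
    and Rb: "R \<longlonglongrightarrow> b" and mR: "(\<lambda>m. real m * R m ^ m) \<longlonglongrightarrow> 0"
  shows "(\<lambda>m. pinned_root.amplitude m \<delta> u (R m)) \<longlonglongrightarrow> limit_amplitude \<delta>"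
    and "limit_amplitude \<delta> > 0"
proof -
  define l where "l = (1 + b)\<^sup>2 / (4 * b)"
  let ?K = "exp (-\<delta>) * (l * (1 - exp (-\<delta>)) / (l - 1)) / ((1 + b\<^sup>2) / (1 - b\<^sup>2) - (1 - exp (-\<delta>)))"
  have K: "limit_amplitude \<delta> = ?K"
    by (simp only: limit_amplitude_def Let_def b_def l_def)
  have b: "0 < b" "b < 1" and ab: "1 - exp (-\<delta>) = (1 - b) / (1 + b)"
    unfolding b_def by (intro exp_c_delta_bounds[OF \<delta>])+
  have b2: "b\<^sup>2 < 1" using b by (simp add: power_less_one_iff)
  have "0 < (1 - b)\<^sup>2" using b by simp
  then have l: "l > 1" using b by (simp add: l_def field_simps power2_eq_square)
  have "(1 + b\<^sup>2) / (1 - b\<^sup>2) \<ge> 1" using b2 by (simp add: field_simps)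
  then have den: "(1 + b\<^sup>2) / (1 - b\<^sup>2) - (1 - exp (-\<delta>)) > 0" using exp_gt_zero[of "-\<delta>"] by linarith
  show "limit_amplitude \<delta> > 0" unfolding K using den l \<delta> by (intro divide_pos_pos mult_pos_pos) auto
  have P: "(\<lambda>m. R m ^ m) \<longlonglongrightarrow> 0"
  proof (rule Lim_null_comparison[OF _ mR])
    show "\<forall>\<^sub>F m in sequentially. norm (R m ^ m) \<le> real m * R m ^ m"
      using root eventually_gt_at_top[of 0]
    proof eventually_elim
      case (elim m)
      then interpret pinned_root m \<delta> u "R m" by simp
      have "1 * R m ^ m \<le> real m * R m ^ m" using elim \<rho>_pos by (intro mult_right_mono) auto
      then show ?case using \<rho>_pos by simp
    qed
  qed
  have cosl: "(\<lambda>m. cos (u / (2 * real m))) \<longlonglongrightarrow> 1"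
  proof -
    have "(\<lambda>m. u / (2 * real m)) \<longlonglongrightarrow> 0"
      by (intro tendsto_divide_0[OF tendsto_const] filterlim_at_top_imp_at_infinity
          filterlim_tendsto_pos_mult_at_top[OF tendsto_const] filterlim_real_sequentially) auto
    from tendsto_cos[OF this] show ?thesis by simp
  qed
  define LL where "LL m = (1 + R m)\<^sup>2 / (4 * R m)" for m
  have LL: "LL \<longlonglongrightarrow> l" unfolding LL_def l_def using b by (intro tendsto_intros Rb) auto
  define PN where "PN m = (1 + (R m ^ m)\<^sup>2 - 2 * R m ^ m * cos u) * (1 + (R m)\<^sup>2) * ((1 - (R m ^ m)\<^sup>2) / (1 - (R m)\<^sup>2))
     + 2 * (real m * R m ^ m) * (cos u * (1 + (R m ^ m)\<^sup>2) - 2 * R m ^ m)" for m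
  have "PN \<longlonglongrightarrow> (1 + 0\<^sup>2 - 2 * 0 * cos u) * (1 + b\<^sup>2) * ((1 - 0\<^sup>2) / (1 - b\<^sup>2)) + 2 * 0 * (cos u * (1 + 0\<^sup>2) - 2 * 0)"
    unfolding PN_def using b2 by (intro tendsto_intros Rb mR P) auto
  then have PN: "PN \<longlonglongrightarrow> (1 + b\<^sup>2) / (1 - b\<^sup>2)" by simp
  have "(\<lambda>m. exp (-\<delta>) * (1 - (R m ^ m)\<^sup>2) * (LL m * (1 - exp (-\<delta>)) * (1 - (R m ^ m)\<^sup>2) / (LL m - (cos (u / (2 * real m)))\<^sup>2))
     / (PN m - (1 - exp (-\<delta>)) * (1 - (R m ^ m)\<^sup>2)\<^sup>2))
     \<longlonglongrightarrow> exp (-\<delta>) * (1 - 0\<^sup>2) * (l * (1 - exp (-\<delta>)) * (1 - 0\<^sup>2) / (l - 1\<^sup>2))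
     / ((1 + b\<^sup>2) / (1 - b\<^sup>2) - (1 - exp (-\<delta>)) * (1 - 0\<^sup>2)\<^sup>2)"
    using l den by (intro tendsto_intros LL PN P cosl) auto
  then have "(\<lambda>m. exp (-\<delta>) * (1 - (R m ^ m)\<^sup>2) * (LL m * (1 - exp (-\<delta>)) * (1 - (R m ^ m)\<^sup>2) / (LL m - (cos (u / (2 * real m)))\<^sup>2))
     / (PN m - (1 - exp (-\<delta>)) * (1 - (R m ^ m)\<^sup>2)\<^sup>2)) \<longlonglongrightarrow> ?K"
    by simp
  moreover have "\<forall>\<^sub>F m in sequentially. exp (-\<delta>) * (1 - (R m ^ m)\<^sup>2) * (LL m * (1 - exp (-\<delta>)) * (1 - (R m ^ m)\<^sup>2) / (LL m - (cos (u / (2 * real m)))\<^sup>2))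
     / (PN m - (1 - exp (-\<delta>)) * (1 - (R m ^ m)\<^sup>2)\<^sup>2) = pinned_root.amplitude m \<delta> u (R m)"
    using root
  proof eventually_elim
    case (elim m)
    then interpret pinned_root m \<delta> u "R m" .
    show ?case unfolding amplitude_def profile_norm_def LL_def PN_def mult.assoc ..
  qed
  ultimately show "(\<lambda>m. pinned_root.amplitude m \<delta> u (R m)) \<longlonglongrightarrow> limit_amplitude \<delta>"
    unfolding K by (rule Lim_transform_eventually)
qed

lemma funpow_plane_wave_limit:
  fixes \<delta> u E :: real and m n :: "nat \<Rightarrow> nat"
  defines "b \<equiv> exp (-2 * c_delta \<delta>)"
  defines "l \<equiv> (1 + b)\<^sup>2 / (4 * b)"
  assumes \<delta>: "\<delta> > 0" and m: "filterlim m at_top sequentially" and mn: "\<And>k. m k \<le> n k"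
    and E: "(\<lambda>k. real (n k) * b ^ m k) \<longlonglongrightarrow> E / 2"
  shows "(\<lambda>k. (pinned_lazy_step (m k) \<delta> ^^ n k) (plane_wave (m k) u) 0 / of_real (l ^ n k))
    \<longlonglongrightarrow> of_real (exp (E * (1 - b)\<^sup>2 / (2 * b) * cos u) *
limit_amplitude \<delta>)"
    (is "?X \<longlonglongrightarrow> of_real (?e * ?K)")
proof -
  have b: "0 < b" "b < 1"
    unfolding b_def by (intro exp_c_delta_bounds[OF \<delta>])+
  have "0 < (1 - b)\<^sup>2" using b by simp
  then have l: "l > 1" using b by (simp add: l_def field_simps power2_eq_square)
  obtain R where root: "\<forall>\<^sub>F m in sequentially. pinned_root m \<delta> u (R m)" and Rb: "R \<longlonglongrightarrow> b"
    and mR: "(\<lambda>m. real m * R m ^ m) \<longlonglongrightarrow> 0" and Rd: "(\<lambda>m. (b - R m) / b ^ m) \<longlonglongrightarrow> (1 - b\<^sup>2) * cos u"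
    using pinned_root_asymptotics[OF \<delta>, of u] unfolding b_def by blast
  note sub = filterlim_compose[OF _ m]
  have rootk: "\<forall>\<^sub>F k in sequentially. pinned_root (m k) \<delta> u (R (m k))"
    using filterlim_iff[THEN iffD1, OF m] root by blast
  have n: "filterlim n at_top sequentially"
    by (rule filterlim_at_top_mono[OF m]) (simp add: mn)
  have amp: "(\<lambda>k. pinned_root.amplitude (m k) \<delta> u (R (m k))) \<longlonglongrightarrow> ?K"
    using amplitude_limit(1)[OF \<delta> root Rb[unfolded b_def] mR] 
    by (rule sub)
  define z where "z k = (b - R (m k)) * (1 - b * R (m k)) / (R (m k) * (1 + b)\<^sup>2)" for k
  have z0: "z \<longlonglongrightarrow> 0"
  proof -
    have "z \<longlonglongrightarrow> (b - b) * (1 - b * b) / (b * (1 + b)\<^sup>2)"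
      unfolding z_def using b by (intro tendsto_intros sub[OF Rb]) auto
    then show ?thesis by simp
  qed
  have nz: "(\<lambda>k. real (n k) * z k) \<longlonglongrightarrow> E * (1 - b)\<^sup>2 / (2 * b) * cos u"
  proof -
    have "(\<lambda>k. (real (n k) * b ^ m k) * ((b - R (m k)) / b ^ m k) * (1 - b * R (m k)) / (R (m k) * (1 + b)\<^sup>2))
       \<longlonglongrightarrow> (E / 2) * ((1 - b\<^sup>2) * cos u) * (1 - b * b) / (b * (1 + b)\<^sup>2)"
      using b by (intro tendsto_intros sub[OF Rb] sub[OF Rd] E) auto
    moreover have "(real (n k) * b ^ m k) * ((b - R (m k)) / b ^ m k) * (1 - b * R (m k)) / (R (m k) * (1 + b)\<^sup>2)
        = real (n k) * z k" for k
      using b by (simp add: z_def)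
    moreover have "(E / 2) * ((1 - b\<^sup>2) * cos u) * (1 - b * b) / (b * (1 + b)\<^sup>2) = E * (1 - b)\<^sup>2 / (2 * b) * cos u"
    proof -
      have "1 - b\<^sup>2 = (1 - b) * (1 + b)" "1 - b * b = (1 - b) * (1 + b)"
        by (simp_all add: algebra_simps power2_eq_square)
      then show ?thesis using b by (simp add: power2_eq_square)
    qed
    ultimately show ?thesis by simp
  qed
  have lim_pow: "(\<lambda>k. (1 + z k) ^ n k) \<longlonglongrightarrow> ?e" by (rule tendsto_power_exp[OF nz z0])
  have main: "(\<lambda>k. complex_of_real ((1 + z k) ^ n k * pinned_root.amplitude (m k) \<delta> u (R (m k)))) \<longlonglongrightarrow> of_real (?e * ?K)"
    by (intro tendsto_of_real tendsto_mult lim_pow amp)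
  have "(\<lambda>k. ?X k - complex_of_real ((1 + z k) ^ n k * pinned_root.amplitude (m k) \<delta> u (R (m k)))) \<longlonglongrightarrow> 0"
  proof (rule Lim_null_comparison)
    have "(\<lambda>j. real j * (1 / l) ^ j) \<longlonglongrightarrow> 0" using l powser_times_n_limit_0[of "1 / l"] by simp
    then show "(\<lambda>k. real (n k) * (1 / l) ^ n k) \<longlonglongrightarrow> 0" by (rule filterlim_compose[OF _ n])
    show "\<forall>\<^sub>F k in sequentially. norm (?X k - complex_of_real ((1 + z k) ^ n k * pinned_root.amplitude (m k) \<delta> u (R (m k))))
        \<le> real (n k) * (1 / l) ^ n k"
      using rootk
    proof eventually_elim
      case (elim k)
      then interpret pinned_root "m k" \<delta> u "R (m k)" .
      define x where "x = R (m k)"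
      have x: "x > 0" using r_pos by (simp add: x_def)
      have "1 + z k = ((1 + x)\<^sup>2 / (4 * x)) / l"
      proof -
        have "1 + (b - x) * (1 - b * x) / (x * (1 + b)\<^sup>2) = (x * (1 + b)\<^sup>2 + (b - x) * (1 - b * x)) / (x * (1 + b)\<^sup>2)"
          using x b by (simp add: add_divide_distrib)
        also have "x * (1 + b)\<^sup>2 + (b - x) * (1 - b * x) = b * (1 + x)\<^sup>2"
          by (simp add: algebra_simps power2_eq_square)
        finally show ?thesis using b x by (simp add: z_def x_def[symmetric] l_def)
      qed
      then have eq: "(1 + z k) ^ n k = L ^ n k / l ^ n k" by (simp only: x_def power_divide)
      have "norm (?X k - complex_of_real ((1 + z k) ^ n k * amplitude))
         = norm (((A ^^ n k) wave 0 - of_real (L ^ n k * amplitude)) / of_real (l ^ n k))"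
        unfolding eq by (simp add: diff_divide_distrib)
      also have "\<dots> = norm ((A ^^ n k) wave 0 - of_real (L ^ n k * amplitude)) / l ^ n k"
        unfolding norm_divide norm_of_real using l by simp
      also have "\<dots> \<le> sqrt (real (m k)) / l ^ n k"
        using l by (intro divide_right_mono funpow_A_wave) auto
      also have "sqrt (real (m k)) \<le> real (n k)"
      proof -
        have "real (m k) \<le> (real (m k))\<^sup>2" by (simp add: power2_eq_square) (metis le_square of_nat_le_iff of_nat_mult)
        then have "sqrt (real (m k)) \<le> real (m k)" by (rule real_le_lsqrt[rotated 1]) simp
        then show ?thesis using mn[of k] by linarith
      qed
      finally show ?case using l by (simp add: divide_right_mono power_divide)
    qed
  qed
  from tendsto_add[OF this main] show ?thesis by simp
qed

subsection \<open>Convergence in law\<close>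

lemma t_param_eq:
  assumes "\<delta> > 0"
  defines "b \<equiv> exp (-2 * c_delta \<delta>)"
  shows "t_param \<delta> \<zeta> = exp (- c_delta \<delta> * \<zeta>) * (1 - b)\<^sup>2 / (2 * b)"
proof -
  define x where "x = exp (-\<delta>)"
  have x: "0 < x" "x < 1" using assms by (auto simp: x_def)
  have b: "b = x / (2 - x)" unfolding b_def x_def by (rule exp_c_delta[OF assms(1)])
  have e: "exp \<delta> = 1 / x" by (simp add: x_def exp_minus field_simps)
  have b1: "1 - b = 2 * (1 - x) / (2 - x)" using x by (simp add: b field_simps)
  have "(1 - b)\<^sup>2 / (2 * b) = 2 * (1 / x) * (1 - x)\<^sup>2 / (2 - x)"
  proof -
    have "(2 * y / d)\<^sup>2 / (2 * (x / d)) = 2 * (1 / x) * y\<^sup>2 / d" if "d > 0" for y d :: real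
      using that x by (simp add: field_simps power2_eq_square)
    from this[of "2 - x" "1 - x"] show ?thesis unfolding b1 unfolding b using x by linarith
  qed
  then show ?thesis
    unfolding t_param_def e x_def[symmetric] by (metis mult.commute times_divide_eq_right)
qed

lemma t_param_pos: "\<delta> > 0 \<Longrightarrow> t_param \<delta> \<zeta> > 0"
  using exp_c_delta_bounds(2)[of \<delta>] by (simp add: t_param_eq)

theorem theorem2:
  fixes \<delta> \<zeta> :: real and T :: "nat \<Rightarrow> nat" and r :: "nat \<Rightarrow> nat"
  assumes "\<delta> > 0"
    and "\<And>N. even (T N)"
    and "\<And>N. T N \<le> N"
    and "filterlim T at_top at_top"
    and "strict_mono r"
    and "(\<lambda>k. real (T (r k)) - ln (real (r k)) / c_delta \<delta>) \<longlonglongrightarrow> \<zeta>"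
  shows "weak_conv_m (\<lambda>k. polymer_rescaled_endpoint (T (r k)) (r k) \<delta>)
           (distr (measure_pmf (srw_at_poisson (t_param \<delta> \<zeta>))) borel real_of_int)"
proof (rule levy_continuity)
  show "real_distribution (polymer_rescaled_endpoint (T (r k)) (r k) \<delta>)" for k
    by (rule real_distribution_polymer_rescaled_endpoint)
  show "real_distribution (distr (measure_pmf (srw_at_poisson (t_param \<delta> \<zeta>))) borel real_of_int)"
    by (rule prob_space.real_distribution_distr) (simp_all add: prob_space_measure_pmf)
next
  fix u :: real
  define c where "c = c_delta \<delta>"
  define b where "b = exp (-2 * c)"
  define l where "l = (1 + b)\<^sup>2 / (4 * b)"
  define E where "E = exp (- c * \<zeta>)"
  define m where "m k = T (r k) div 2" for k
  define n where "n k = r k div 2" for k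
  have T: "T (r k) = 2 * m k" for k using assms(2) by (simp add: m_def)
  have b: "0 < b" "b < 1" using exp_c_delta_bounds[OF assms(1)] by (auto simp: b_def c_def)
  have c: "c > 0" using b by (simp add: b_def)
  have l: "l > 0" using b by (simp add: l_def)
  have r: "filterlim r at_top sequentially" using assms(5) by (rule filterlim_subseq)
  have Tr: "filterlim (\<lambda>k. T (r k)) at_top sequentially" by (rule filterlim_compose[OF assms(4) r])
  have m: "filterlim m at_top sequentially"
    unfolding filterlim_at_top
  proof
    fix Z
    have "\<forall>\<^sub>F k in sequentially. 2 * Z \<le> T (r k)" using Tr by (simp add: filterlim_at_top)
    then show "\<forall>\<^sub>F k in sequentially. Z \<le> m k" by eventually_elim (simp add: T)
  qed
  have mn: "m k \<le> n k" for k unfolding m_def n_def using assms(3) by (intro div_le_mono)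
  have Nb: "(\<lambda>k. real (r k) * b ^ m k) \<longlonglongrightarrow> E"
  proof -
    have "(\<lambda>k. exp (- c * (real (T (r k)) - ln (real (r k)) / c))) \<longlonglongrightarrow> E"
      unfolding E_def c_def by (intro tendsto_intros assms(6))
    moreover have "\<forall>\<^sub>F k in sequentially. exp (- c * (real (T (r k)) - ln (real (r k)) / c)) = real (r k) * b ^ m k"
      using eventually_compose_filterlim[OF eventually_gt_at_top[of 0] r]
    proof eventually_elim
      case (elim k)
      have "- c * (real (T (r k)) - ln (real (r k)) / c) = ln (real (r k)) + real (m k) * (-2 * c)"
        using c by (simp add: T field_simps)
      then show ?case using elim by (simp only: exp_add b_def exp_of_nat_mult) simp
    qed
    ultimately show ?thesis by (rule Lim_transform_eventually)
  qed
  have nb: "(\<lambda>k. real (n k) * b ^ m k) \<longlonglongrightarrow> E / 2"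
  proof -
    have "(\<lambda>k. b ^ m k) \<longlonglongrightarrow> 0"
      by (rule filterlim_compose[OF LIMSEQ_realpow_zero m]) (use b in auto)
    then have small: "(\<lambda>k. real (r k mod 2) * b ^ m k) \<longlonglongrightarrow> 0"
      by (rule Lim_null_comparison[rotated]) (use b in \<open>auto intro!: always_eventually mult_left_le_one_le\<close>)
    have "(\<lambda>k. (real (r k) * b ^ m k - real (r k mod 2) * b ^ m k) / 2) \<longlonglongrightarrow> (E - 0) / 2"
      by (intro tendsto_intros Nb small) auto
    moreover have "(real (r k) * b ^ m k - real (r k mod 2) * b ^ m k) / 2 = real (n k) * b ^ m k" for k
    proof -
      have "real (r k) = real (r k mod 2) + 2 * real (n k)"
        unfolding n_def by (metis mod_mult_div_eq of_nat_add of_nat_mult of_nat_numeral)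
      then show ?thesis by (simp add: algebra_simps)
    qed
    ultimately show ?thesis by simp
  qed
  define X where "X v k = (pinned_lazy_step (m k) \<delta> ^^ n k) (plane_wave (m k) v) 0 / of_real (l ^ n k)" for v k
  define t where "t = t_param \<delta> \<zeta>"
  have X: "X v \<longlonglongrightarrow> of_real (exp (t * cos v) * limit_amplitude \<delta>)" for v
    unfolding X_def t_def l_def b_def c_def t_param_eq[OF assms(1)]
    using funpow_plane_wave_limit[OF assms(1) m mn, of E v] nb by (simp only: b_def c_def E_def)
  obtain R where "\<forall>\<^sub>F m in sequentially. pinned_root m \<delta> u (R m)" "R \<longlonglongrightarrow> exp (-2 * c_delta \<delta>)"
    "(\<lambda>m. real m * R m ^ m) \<longlonglongrightarrow> 0"
    using pinned_root_asymptotics[OF assms(1), of u] by blast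
  then have K: "limit_amplitude \<delta> > 0" by (rule amplitude_limit(2)[OF assms(1)])
  define d where "d k = (if even (r k) then 1 else cos (u / real (T (r k))))" for k
  have d: "d \<longlonglongrightarrow> 1"
  proof -
    have "(\<lambda>k. u / real (T (r k))) \<longlonglongrightarrow> 0"
      by (intro tendsto_divide_0[OF tendsto_const] filterlim_at_top_imp_at_infinity
          filterlim_compose[OF filterlim_real_sequentially Tr])
    from tendsto_cos[OF this] have "(\<lambda>k. cos (u / real (T (r k))) - 1) \<longlonglongrightarrow> 0"
      by (simp add: LIM_zero_iff)
    then have "(\<lambda>k. d k - 1) \<longlonglongrightarrow> 0"
      by (rule tendsto_0_le[where K = 1]) (auto simp: d_def)
    then show ?thesis by (simp add: LIM_zero_iff)
  qed
  have "(\<lambda>k. of_real (d k) * (X u k / X 0 k)) \<longlonglongrightarrow>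
     of_real 1 * (of_real (exp (t * cos u) * limit_amplitude \<delta>) / of_real (exp (t * cos 0) * limit_amplitude \<delta>))"
    using K by (intro tendsto_mult tendsto_divide X tendsto_of_real d) auto
  also have "of_real 1 * (of_real (exp (t * cos u) * limit_amplitude \<delta>) / of_real (exp (t * cos 0) * limit_amplitude \<delta>))
     = complex_of_real (exp (t * (cos u - 1)))"
    using K by (simp add: exp_diff right_diff_distrib del: of_real_exp flip: of_real_mult of_real_divide)
  also have "\<dots> = char (distr (measure_pmf (srw_at_poisson (t_param \<delta> \<zeta>))) borel real_of_int) u"
    unfolding t_def by (rule char_srw_at_poisson[OF t_param_pos[OF assms(1)], symmetric])
  finally have lim: "(\<lambda>k. of_real (d k) * (X u k / X 0 k)) \<longlonglongrightarrow>
     char (distr (measure_pmf (srw_at_poisson (t_param \<delta> \<zeta>))) borel real_of_int) u" .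
  have "\<forall>\<^sub>F k in sequentially. of_real (d k) * (X u k / X 0 k) = char (polymer_rescaled_endpoint (T (r k)) (r k) \<delta>) u"
    using eventually_compose_filterlim[OF eventually_gt_at_top[of 0] m]
  proof eventually_elim
    case (elim k)
    show ?case
      using tilted_avg_eq_funpow[OF elim, of \<delta> u "r k"] tilted_avg_eq_funpow[OF elim, of \<delta> 0 "r k"] l
      unfolding char_polymer_rescaled_endpoint by (simp add: T X_def d_def n_def)
  qed
  from Lim_transform_eventually[OF lim this]
  show "(\<lambda>k. char (polymer_rescaled_endpoint (T (r k)) (r k) \<delta>) u) \<longlonglongrightarrow>
     char (distr (measure_pmf (srw_at_poisson (t_param \<delta> \<zeta>))) borel real_of_int) u" .
qed

end
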